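(* If $k\ge 3$, then the perfect matching derangement graph $M(2k)$ is not a Cayley graph.
   Context: A perfect matching of $K_{2k}$ is a set of $k$ pairwise vertex-disjoint edges. $M(2k)$ is the graph whose vertices are the perfect matchings of $K_{2k}$, two being adjacent iff they share no edge. A graph is a Cayley graph if it is isomorphic to $\mathrm{Cay}(G,C)$ for some group $G$ and inverse-closed subset $C\subseteq G\setminus\{1\}$, with vertex set $G$ and $g\sim h$ iff $hg^{-1}\in C$. *)

theory Defs
  imports "HOL-Algebra.Group"
begin

definition complete_edges :: "nat \<Rightarrow> nat set set" where
  "complete_edges n = {e. \<exists>a b. a \<noteq> b \<and> a < n \<and> b < n \<and> e = {a, b}}"

definition perfect_matching :: "nat \<Rightarrow> nat set set \<Rightarrow> bool" where
  "perfect_matching n M \<longleftrightarrow> M \<subseteq> complete_edges n \<and> (\<forall>v<n. \<exists>!e. e \<in> M \<and> v \<in> e)"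

definition PM_vertices :: "nat \<Rightarrow> nat set set set" where
  "PM_vertices n = {M. perfect_matching n M}"

definition PM_adj :: "nat set set \<Rightarrow> nat set set \<Rightarrow> bool" where
  "PM_adj M N \<longleftrightarrow> M \<inter> N = {}"

definition cayley_connection_set :: "('g, 'b) monoid_scheme \<Rightarrow> 'g set \<Rightarrow> bool" where
  "cayley_connection_set G C \<longleftrightarrow> group G \<and> C \<subseteq> carrier G - {\<one>\<^bsub>G\<^esub>}
     \<and> (\<forall>c\<in>C. inv\<^bsub>G\<^esub> c \<in> C)"

definition cayley_adj :: "('g, 'b) monoid_scheme \<Rightarrow> 'g set \<Rightarrow> 'g \<Rightarrow> 'g \<Rightarrow> bool" where
  "cayley_adj G C g h \<longleftrightarrow> h \<otimes>\<^bsub>G\<^esub> inv\<^bsub>G\<^esub> g \<in> C"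

definition cayley_iso :: "('g, 'b) monoid_scheme \<Rightarrow> 'g set \<Rightarrow> 'v set \<Rightarrow> ('v \<Rightarrow> 'v \<Rightarrow> bool) \<Rightarrow> ('g \<Rightarrow> 'v) \<Rightarrow> bool" where
  "cayley_iso G C V adj f \<longleftrightarrow> cayley_connection_set G C \<and> bij_betw f (carrier G) V
     \<and> (\<forall>g\<in>carrier G. \<forall>h\<in>carrier G. cayley_adj G C g h \<longleftrightarrow> adj (f g) (f h))"

end

theory Submission
  imports Defs "HOL-Combinatorics.Permutations"
begin

text \<open>
  Every automorphism of the graph comes from a vertex permutation: three distinct, pairwise
  intersecting matchings form a \<^emph>\<open>line\<close> if every matching intersecting two of them intersects the
  third; lines are the triples \<open>R \<union> {ab, cd}\<close>, \<open>R \<union> {ac, bd}\<close>, \<open>R \<union> {ad, bc}\<close>. Comparing lines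
  through \<open>M\<close> one recovers when \<open>M \<inter> N\<close> and \<open>M \<inter> P\<close> are the same single edge, so an automorphism
  permutes the edges of the complete graph, preserving incidence, and hence its vertices.

  A Cayley representation thus yields a group \<open>P\<close> of permutations of the \<open>2k\<close> points that is regular
  on perfect matchings. An involution of the points fixes a matching, so \<open>P\<close> has no involution and
  \<open>|P|\<close> is odd. A group of odd order that is transitive on matchings fixes a point and is transitive
  on the others: two points inside and two outside an orbit allow a switch that changes the number
  of edges inside the orbit, and orbits have odd length. So \<open>P\<close> fixes some \<open>v\<close>, and by the same
  argument the stabiliser of any \<open>a \<noteq> v\<close> fixes exactly one further point \<open>s a\<close>. Then \<open>s\<close> is a
  fixed-point-free involution of the \<open>2k - 1\<close> points other than \<open>v\<close>, which is impossible.
\<close>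

section \<open>Extending partial matchings\<close>

definition matching :: "'a set set \<Rightarrow> bool" where
  "matching M \<longleftrightarrow> (\<forall>e\<in>M. card e = 2) \<and> pairwise disjnt M"

text \<open>The vertex set is an arbitrary parameter, so deleting the endpoints of a chosen edge
  gives a smaller instance of the same notion. \<open>matching\<close> alone describes families that
  merely have to be avoided.\<close>

definition pm :: "'a set \<Rightarrow> 'a set set \<Rightarrow> bool" where
  "pm V M \<longleftrightarrow> matching M \<and> \<Union>M = V"

lemma matchingD: "matching M \<Longrightarrow> e \<in> M \<Longrightarrow> e' \<in> M \<Longrightarrow> x \<in> e \<Longrightarrow> x \<in> e' \<Longrightarrow> e = e'"
  by (auto simp: matching_def pairwise_def disjnt_def)

lemma pm_imp_matching: "pm V M \<Longrightarrow> matching M"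
  by (simp add: pm_def)

lemma pm_card_edge: "pm V M \<Longrightarrow> e \<in> M \<Longrightarrow> card e = 2"
  by (auto simp: pm_def matching_def)

lemma pm_edge_subset: "pm V M \<Longrightarrow> e \<in> M \<Longrightarrow> e \<subseteq> V"
  by (auto simp: pm_def)

lemma pm_edge_eq: "pm V M \<Longrightarrow> e \<in> M \<Longrightarrow> e' \<in> M \<Longrightarrow> x \<in> e \<Longrightarrow> x \<in> e' \<Longrightarrow> e = e'"
  by (rule matchingD[OF pm_imp_matching])

lemma pm_cover: "pm V M \<Longrightarrow> v \<in> V \<Longrightarrow> \<exists>e\<in>M. v \<in> e"
  by (auto simp: pm_def)

lemma pmI:
  assumes "\<And>e. e \<in> M \<Longrightarrow> card e = 2" "\<And>e. e \<in> M \<Longrightarrow> e \<subseteq> V"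
    "\<And>v. v \<in> V \<Longrightarrow> \<exists>e\<in>M. v \<in> e"
    "\<And>e e' x. e \<in> M \<Longrightarrow> e' \<in> M \<Longrightarrow> x \<in> e \<Longrightarrow> x \<in> e' \<Longrightarrow> e = e'"
  shows "pm V M"
  unfolding pm_def matching_def pairwise_def disjnt_def
proof (intro conjI ballI impI)
  show "\<Union>M = V" using assms(2,3) by blast
qed (use assms(1,4) in blast)+

lemma pm_finite: "finite V \<Longrightarrow> pm V M \<Longrightarrow> finite M"
  by (auto simp: pm_def intro: finite_UnionD)

lemma pm_card:
  assumes "finite V" "pm V M" shows "card V = 2 * card M"
proof -
  have "2 * card M = card (\<Union>M)"
    using assms pm_finite[OF assms]
    by (intro card_partition) (auto simp: pm_def matching_def pairwise_def disjnt_def)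
  then show ?thesis using assms by (simp add: pm_def)
qed

text \<open>A vertex of an edge of \<open>N\<close> is already covered by an edge of
  \<open>M\<close>, which lies in \<open>N\<close> and hence is that same edge. This turns
  inclusions between perfect matchings into equalities.\<close>

lemma pm_subset_eq: "pm V M \<Longrightarrow> pm V N \<Longrightarrow> M \<subseteq> N \<Longrightarrow> M = N"
proof (intro equalityI subsetI)
  fix e assume *: "pm V M" "pm V N" "M \<subseteq> N" "e \<in> N"
  then have "e \<noteq> {}" using pm_card_edge[of V N e] by auto
  then obtain x where x: "x \<in> e" by auto
  then obtain g where "g \<in> M" "x \<in> g" using * pm_cover[of V M x] pm_edge_subset[of V N e] by blast
  then have "g = e" using x * pm_edge_eq[of V N g e x] by blast
  then show "e \<in> M" using \<open>g \<in> M\<close> by simp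
qed auto

lemma pm_Un:
  assumes "pm V M" "pm W N" "V \<inter> W = {}" shows "pm (V \<union> W) (M \<union> N)"
proof (rule pmI)
  fix e assume "e \<in> M \<union> N" then show "card e = 2" "e \<subseteq> V \<union> W"
    using assms(1,2) by (auto dest: pm_card_edge pm_edge_subset)
next
  fix v assume "v \<in> V \<union> W" then show "\<exists>e\<in>M \<union> N. v \<in> e"
    using pm_cover[OF assms(1)] pm_cover[OF assms(2)] by blast
next
  fix e e' x assume *: "e \<in> M \<union> N" "e' \<in> M \<union> N" and x: "x \<in> e" "x \<in> e'"
  have "g \<notin> M \<or> x \<notin> g \<or> x \<in> V" "g \<notin> N \<or> x \<notin> g \<or> x \<in> W" for g
    using assms(1,2) by (auto dest: pm_edge_subset)
  then consider "e \<in> M" "e' \<in> M" | "e \<in> N" "e' \<in> N"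
    using * x assms(3) by blast
  then show "e = e'"
    using x by cases (metis pm_edge_eq[OF assms(1)], metis pm_edge_eq[OF assms(2)])
qed

lemma pm_single: "card e = 2 \<Longrightarrow> pm e {e}"
  by (auto simp: pm_def matching_def)

lemma pm_insert:
  assumes "pm (V - e) M" "card e = 2" "e \<subseteq> V" shows "pm V (insert e M)"
  using pm_Un[OF pm_single[OF assms(2)] assms(1)] assms(3) by (simp add: Un_absorb1)

lemma pm_diff:
  assumes "pm V M" "N \<subseteq> M" shows "pm (V - \<Union>N) (M - N)"
proof (rule pmI)
  fix e assume e: "e \<in> M - N" then show "card e = 2"
    using assms by (auto dest: pm_card_edge)
  show "e \<subseteq> V - \<Union>N"
  proof
    fix x assume "x \<in> e"
    then show "x \<in> V - \<Union>N"
      using assms(2) e pm_edge_eq[OF assms(1), of e _ x] pm_edge_subset[OF assms(1), of e] by auto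
  qed
next
  fix v assume "v \<in> V - \<Union>N" then show "\<exists>e\<in>M-N. v \<in> e" using assms pm_cover[OF assms(1)] by blast
next
  fix e e' x assume "e \<in> M-N" "e' \<in> M-N" "x \<in> e" "x \<in> e'"
  then show "e = e'" using pm_edge_eq[OF assms(1)] by blast
qed

lemma card2_eq: "card e = 2 \<Longrightarrow> x \<in> e \<Longrightarrow> y \<in> e \<Longrightarrow> x \<noteq> y \<Longrightarrow> e = {x, y}"
  by (auto simp: card_2_iff)

lemma card2_subset_eq: "card e = 2 \<Longrightarrow> card f = 2 \<Longrightarrow> e \<subseteq> f \<Longrightarrow> e = f"
  by (auto simp: card_2_iff)

text \<open>If \<open>x\<close> is unmatched, \<open>z\<close> is arbitrary; one vertex to avoid
  then serves both cases.\<close>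

lemma matching_single_nbr:
  assumes "matching M" obtains z where "\<And>y. {x, y} \<in> M \<Longrightarrow> y = z"
proof -
  have "y = z" if "{x, y} \<in> M" "{x, z} \<in> M" for y z
  proof -
    have "{x, y} = {x, z}" using matchingD[OF assms that, of x] by auto
    then show ?thesis by (auto simp: doubleton_eq_iff)
  qed
  then show ?thesis using that by blast
qed

lemma pm_exists:
  assumes "finite V" "even (card V)" shows "\<exists>M. pm V M"
  using assms
proof (induction "card V" arbitrary: V rule: less_induct)
  case less
  show ?case
  proof (cases "V = {}")
    case True then have "pm V {}" by (auto simp: pm_def matching_def)
    then show ?thesis by blast
  next
    case False
    then have "card V \<ge> 2" using less.prems by (metis Suc_1 Suc_leI card_gt_0_iff le_neq_implies_less odd_one One_nat_def)
    then obtain e where e: "e \<subseteq> V" "card e = 2" by (meson obtain_subset_with_card_n)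
    then have "card (V - e) = card V - 2" using less.prems by (simp add: card_Diff_subset finite_subset)
    then obtain M where "pm (V - e) M" using less \<open>card V \<ge> 2\<close> by (metis diff_less dvd_diff_nat dvd_refl finite_Diff less_le_trans zero_less_numeral)
    then show ?thesis using e pm_insert by blast
  qed
qed

section \<open>Perfect matchings that avoid two given matchings\<close>

lemma pm_quad:
  assumes "distinct [a, b, c, d]" shows "pm {a, b, c, d} {{a, b}, {c, d}}"
proof -
  have "pm ({a, b} \<union> {c, d}) ({{a, b}} \<union> {{c, d}})"
    using assms by (intro pm_Un pm_single) auto
  then show ?thesis by (simp add: insert_commute)
qed

text \<open>Four points have three perfect matchings, and edges from two different ones always meet
  in a point. So a matching shares edges with at most one of the three, and \<open>A\<close> and
  \<open>B\<close> together rule out at most two.\<close>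

lemma pm_avoid_two_quad:
  assumes "card V = 4" "matching A" "matching B"
  shows "\<exists>C. pm V C \<and> C \<inter> A = {} \<and> C \<inter> B = {}"
proof -
  obtain a b c d where V: "V = {a, b, c, d}" and d: "distinct [a, b, c, d]"
    using assms(1) by (auto simp: card_Suc_eq numeral_eq_Suc)
  let ?C = "{{a, b}, {c, d}}" and ?D = "{{a, c}, {b, d}}" and ?E = "{{a, d}, {b, c}}"
  have "{a, c, b, d} = V" "{a, d, b, c} = V" using V by auto
  then have p: "pm V ?C" "pm V ?D" "pm V ?E"
    using pm_quad[of a b c d] pm_quad[of a c b d] pm_quad[of a d b c] d V by auto
  have share: False if "matching X" "e \<in> X" "e' \<in> X" "e \<inter> e' \<noteq> {}" "e \<noteq> e'" for X :: "'a set set" and e e'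
    using that matchingD[of X e e'] by blast
  have disj: "C \<inter> X = {} \<or> D \<inter> X = {}" if "matching X" "\<And>e e'. e \<in> C \<Longrightarrow> e' \<in> D \<Longrightarrow> e \<inter> e' \<noteq> {} \<and> e \<noteq> e'"
    for X C D :: "'a set set"
    using that share[OF that(1)] by blast
  have CD: "e \<inter> e' \<noteq> {} \<and> e \<noteq> e'" if "e \<in> ?C" "e' \<in> ?D" for e e'
    using that d by (elim insertE emptyE; hypsubst; simp add: doubleton_eq_iff; metis)
  have CE: "e \<inter> e' \<noteq> {} \<and> e \<noteq> e'" if "e \<in> ?C" "e' \<in> ?E" for e e'
    using that d by (elim insertE emptyE; hypsubst; simp add: doubleton_eq_iff; metis)
  have DE: "e \<inter> e' \<noteq> {} \<and> e \<noteq> e'" if "e \<in> ?D" "e' \<in> ?E" for e e'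
    using that d by (elim insertE emptyE; hypsubst; simp add: doubleton_eq_iff; metis)
  have three: "\<exists>X\<in>{C, D, E}. P X \<and> Q X"
    if "P C \<or> P D" "P C \<or> P E" "P D \<or> P E" "Q C \<or> Q D" "Q C \<or> Q E" "Q D \<or> Q E"
    for C D E :: "'a set set" and P Q
    using that by blast
  have "\<exists>X\<in>{?C, ?D, ?E}. X \<inter> A = {} \<and> X \<inter> B = {}"
    using disj[OF assms(2) CD] disj[OF assms(2) CE] disj[OF assms(2) DE]
      disj[OF assms(3) CD] disj[OF assms(3) CE] disj[OF assms(3) DE]
    by (rule three[where P = "\<lambda>X. X \<inter> A = {}" and Q = "\<lambda>X. X \<inter> B = {}"])
  then show ?thesis using p by blast
qed

text \<open>Induction from four points upwards: join some \<open>x\<close> to a \<open>y\<close>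
  that is its partner neither in \<open>A\<close> nor in \<open>B\<close>, and delete both. Beyond
  the base case there are at least six points, so at least four remain.\<close>

lemma pm_avoid_two:
  assumes "finite V" "even (card V)" "card V \<ge> 4" "matching A" "matching B"
  shows "\<exists>C. pm V C \<and> C \<inter> A = {} \<and> C \<inter> B = {}"
  using assms(1-3)
proof (induction "card V" arbitrary: V rule: less_induct)
  case less
  show ?case
  proof (cases "card V = 4")
    case True then show ?thesis using pm_avoid_two_quad assms by blast
  next
    case False
    then have ge: "card V \<ge> 6" using less.prems by presburger
    then obtain x where x: "x \<in> V" by fastforce
    obtain z where z: "\<And>y. {x, y} \<in> A \<Longrightarrow> y = z" using matching_single_nbr[OF assms(4)] by blast
    obtain w where w: "\<And>y. {x, y} \<in> B \<Longrightarrow> y = w" using matching_single_nbr[OF assms(5)] by blast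
    have "card {x, z, w} \<le> 3" using card_length[of "[x, z, w]"] by simp
    then have "\<not> V \<subseteq> {x, z, w}" using ge card_mono[of "{x, z, w}" V] by auto
    then obtain y where y: "y \<in> V" "y \<noteq> x" "y \<noteq> z" "y \<noteq> w" by blast
    let ?e = "{x, y}"
    have c: "card (V - ?e) = card V - 2" using x y less.prems by (simp add: card_Diff_subset)
    then have "even (card (V - ?e))" "card (V - ?e) \<ge> 4" "card (V - ?e) < card V" using ge less.prems by auto
    then obtain C where C: "pm (V - ?e) C" "C \<inter> A = {}" "C \<inter> B = {}" using less by blast
    have "pm V (insert ?e C)" using C x y by (intro pm_insert) auto
    moreover have "?e \<notin> A" "?e \<notin> B" using z w y by blast+
    ultimately show ?thesis using C by blast
  qed
qed

section \<open>Lines of matchings\<close>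

text \<open>Deleting \<open>e\<close> must leave four points, hence the bound 6. The result is the
  standard source of a matching that meets a given one in exactly a prescribed edge.\<close>

lemma pm_extend_edge:
  assumes "finite V" "even (card V)" "card V \<ge> 6" "card e = 2" "e \<subseteq> V" "matching A" "matching B"
  shows "\<exists>C. pm V C \<and> e \<in> C \<and> C \<inter> A \<subseteq> {e} \<and> C \<inter> B \<subseteq> {e}"
proof -
  have "card (V - e) = card V - 2" using assms by (simp add: card_Diff_subset finite_subset)
  then have "even (card (V - e))" "card (V - e) \<ge> 4" using assms by auto
  then obtain C where "pm (V - e) C" "C \<inter> A = {}" "C \<inter> B = {}"
    using pm_avoid_two[of "V - e" A B] assms by auto
  then show ?thesis
    using pm_insert[of V e C] assms(4,5) by (intro exI[of _ "insert e C"]) auto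
qed

lemma pm_extend_two_edges:
  assumes "finite V" "even (card V)" "card V \<ge> 8" "card e = 2" "e \<subseteq> V" "card e' = 2" "e' \<subseteq> V"
    "e \<inter> e' = {}" "matching A"
  shows "\<exists>C. pm V C \<and> e \<in> C \<and> e' \<in> C \<and> C \<inter> A \<subseteq> {e, e'}"
proof -
  have "card (V - e) = card V - 2" using assms by (simp add: card_Diff_subset finite_subset)
  then have "even (card (V - e))" "card (V - e) \<ge> 6" using assms by auto
  then obtain C where "pm (V - e) C" "e' \<in> C" "C \<inter> A \<subseteq> {e'}"
    using pm_extend_edge[of "V - e" e' A A] assms by auto
  then show ?thesis
    using pm_insert[of V e C] assms(4,5) by (intro exI[of _ "insert e C"]) auto
qed

text \<open>If \<open>e\<close> were the only edge of \<open>M\<close> outside \<open>N\<close>, all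
  other edges of \<open>M\<close> would belong to \<open>N\<close>, leaving only the two ends of
  \<open>e\<close> for the remaining edge of \<open>N\<close>; that edge would be \<open>e\<close>
  itself.\<close>

lemma pm_card_diff_ge_2:
  assumes "finite V" "pm V M" "pm V N" "M \<noteq> N" shows "card (M - N) \<ge> 2"
proof (rule ccontr)
  assume "\<not> 2 \<le> card (M - N)"
  moreover have "M - N \<noteq> {}" using pm_subset_eq[OF assms(2,3)] assms(4) by auto
  moreover have fin: "finite (M - N)" using pm_finite[OF assms(1,2)] by auto
  ultimately have "card (M - N) = 1" using card_0_eq[OF fin] by linarith
  then obtain e where e: "M - N = {e}" by (metis card_1_singletonE)
  then have "e \<subseteq> V" "card e = 2" using assms(2) by (auto dest: pm_edge_subset pm_card_edge)
  then obtain x where x: "x \<in> e" "x \<in> V" by (auto simp: card_2_iff)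
  then obtain g where g: "g \<in> N" "x \<in> g" using pm_cover[OF assms(3)] by blast
  have "g \<subseteq> e"
  proof
    fix y assume y: "y \<in> g"
    then have "y \<in> V" using g pm_edge_subset[OF assms(3)] by blast
    then obtain h where h: "h \<in> M" "y \<in> h" using pm_cover[OF assms(2)] by blast
    show "y \<in> e"
    proof (cases "h = e")
      case False
      then have "h \<in> N" using h e by blast
      then have "h = g" using pm_edge_eq[OF assms(3), of h g y] g h y by simp
      then have "h = e" using pm_edge_eq[OF assms(2), of h e x] h(1) x g e by auto
      then show ?thesis using h by simp
    qed (use h in simp)
  qed
  then have "g = e" using card2_subset_eq \<open>card e = 2\<close> pm_card_edge[OF assms(3) g(1)] by blast
  then show False using g e by auto
qed

lemma pm_card_eq: "finite V \<Longrightarrow> pm V M \<Longrightarrow> pm V N \<Longrightarrow> card M = card N"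
  using pm_card[of V M] pm_card[of V N] by simp

lemma pm_card_diff_eq:
  assumes "finite V" "pm V M" "pm V N" shows "card (M - N) = card (N - M)"
proof -
  have "finite M" "finite N" using assms pm_finite by auto
  then show ?thesis using pm_card_eq[OF assms]
    by (metis card_Diff_subset_Int finite_Int inf_commute)
qed

text \<open>For \<open>|V| \<ge> 6\<close> the lines are exactly the triples of matchings that agree outside four points
  and run through the three matchings of these four points. The definition only mentions
  disjointness of matchings, so graph automorphisms preserve lines.\<close>

definition line :: "'a set \<Rightarrow> 'a set set \<Rightarrow> 'a set set \<Rightarrow> 'a set set \<Rightarrow> bool" where
  "line V M M' M'' \<longleftrightarrow> pm V M \<and> pm V M' \<and> pm V M'' \<and> M \<noteq> M'
    \<and> M \<inter> M' \<noteq> {} \<and> M \<inter> M'' \<noteq> {} \<and> M' \<inter> M'' \<noteq> {}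
    \<and> (\<forall>N. pm V N \<longrightarrow> (N \<inter> M \<noteq> {} \<longrightarrow> N \<inter> M' \<noteq> {} \<longrightarrow> N \<inter> M'' \<noteq> {})
       \<and> (N \<inter> M \<noteq> {} \<longrightarrow> N \<inter> M'' \<noteq> {} \<longrightarrow> N \<inter> M' \<noteq> {})
       \<and> (N \<inter> M' \<noteq> {} \<longrightarrow> N \<inter> M'' \<noteq> {} \<longrightarrow> N \<inter> M \<noteq> {}))"

lemma line_pm: "line V M M' M'' \<Longrightarrow> pm V M" "line V M M' M'' \<Longrightarrow> pm V M'" "line V M M' M'' \<Longrightarrow> pm V M''"
  by (simp_all add: line_def)

lemma line_meets:
  assumes "line V M M' M''" "pm V N"
  shows "N \<inter> M \<noteq> {} \<Longrightarrow> N \<inter> M' \<noteq> {} \<Longrightarrow> N \<inter> M'' \<noteq> {}"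
    "N \<inter> M \<noteq> {} \<Longrightarrow> N \<inter> M'' \<noteq> {} \<Longrightarrow> N \<inter> M' \<noteq> {}"
    "N \<inter> M' \<noteq> {} \<Longrightarrow> N \<inter> M'' \<noteq> {} \<Longrightarrow> N \<inter> M \<noteq> {}"
  using assms by (simp_all add: line_def)

text \<open>With three or more differing edges there are disjoint edges \<open>e\<close> in
  \<open>M - M'\<close> and \<open>e'\<close> in \<open>M' - M\<close>. A matching through both that
  otherwise avoids \<open>M''\<close> meets \<open>M\<close> and \<open>M'\<close>, hence
  \<open>M''\<close>, so one of the two edges lies in \<open>M''\<close>; but edges shared by two
  matchings of a line lie in the third.\<close>

lemma line_card_diff:
  assumes V: "finite V" "even (card V)" "card V \<ge> 6" and l: "line V M M' M''"
  shows "card (M - M') = 2"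
proof (rule ccontr)
  assume "card (M - M') \<noteq> 2"
  have pm: "pm V M" "pm V M'" "pm V M''" and ne: "M \<noteq> M'" and meet: "M \<inter> M' \<noteq> {}"
    using l by (auto simp: line_def)
  have three: "card (M - M') \<ge> 3"
    using pm_card_diff_ge_2[OF V(1) pm(1,2) ne] \<open>card (M - M') \<noteq> 2\<close> by simp
  have ext: "\<exists>N. pm V N \<and> e \<in> N \<and> N \<inter> X \<subseteq> {e}" if "e \<in> Y" "pm V Y" "pm V X" for e X Y
    using pm_extend_edge[OF V, of e X X] that pm_card_edge[OF that(2)] pm_edge_subset[OF that(2)]
      pm_imp_matching[OF that(3)] by blast
  \<comment> \<open>An edge common to two of the matchings lies in the third: a matching through it
    that meets the third in at most that edge must still meet the third.\<close>
  have sub1: "M \<inter> M' \<subseteq> M''"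
  proof
    fix e assume e: "e \<in> M \<inter> M'"
    obtain N where "pm V N" "e \<in> N" "N \<inter> M'' \<subseteq> {e}" using ext[of e M M''] e pm by blast
    then show "e \<in> M''" using e line_meets(1)[OF l, of N] by blast
  qed
  have sub2: "M \<inter> M'' \<subseteq> M'"
  proof
    fix e assume e: "e \<in> M \<inter> M''"
    obtain N where "pm V N" "e \<in> N" "N \<inter> M' \<subseteq> {e}" using ext[of e M M'] e pm by blast
    then show "e \<in> M'" using e line_meets(2)[OF l, of N] by blast
  qed
  have sub3: "M' \<inter> M'' \<subseteq> M"
  proof
    fix e assume e: "e \<in> M' \<inter> M''"
    obtain N where "pm V N" "e \<in> N" "N \<inter> M \<subseteq> {e}" using ext[of e M' M] e pm by blast
    then show "e \<in> M" using e line_meets(3)[OF l, of N] by blast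
  qed
  have fin: "finite M" "finite M'" using pm V(1) pm_finite by blast+
  have "card M = card (M - M') + card (M \<inter> M')"
    using fin by (metis card_Diff_subset_Int card_mono finite_Int inf_le1 le_add_diff_inverse2)
  moreover have "card (M \<inter> M') \<ge> 1" using meet fin by (simp add: Suc_leI card_gt_0_iff)
  \<comment> \<open>Three differing edges and one shared edge make at least eight vertices, the room
    needed to prescribe two edges.\<close>
  ultimately have "card V \<ge> 8" using pm_card[OF V(1) pm(1)] three by simp
  obtain e where e: "e \<in> M" "e \<notin> M'" using three by (metis DiffE card.empty ex_in_conv not_numeral_le_zero)
  have e2: "card e = 2" "e \<subseteq> V" using e pm_card_edge[OF pm(1)] pm_edge_subset[OF pm(1)] by auto
  obtain x y where xy: "e = {x, y}" using e2 by (auto simp: card_2_iff)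
  \<comment> \<open>\<open>gx\<close> and \<open>gy\<close> are the edges of \<open>M'\<close> at
    the two ends of \<open>e\<close>. Any other edge of \<open>M'\<close> is disjoint from
    \<open>e\<close>, and \<open>M' - M\<close> has at least three edges.\<close>
  obtain gx gy where g: "gx \<in> M'" "x \<in> gx" "gy \<in> M'" "y \<in> gy" using pm_cover[OF pm(2)] e2 xy by (metis insert_subset)
  have "card (M' - M) \<ge> 3" using three pm_card_diff_eq[OF V(1) pm(1,2)] by simp
  moreover have "card {gx, gy} \<le> 2" using card_length[of "[gx, gy]"] by simp
  ultimately have "\<not> M' - M \<subseteq> {gx, gy}" using card_mono[of "{gx, gy}" "M' - M"] by auto
  then obtain e' where e': "e' \<in> M'" "e' \<notin> M" "e' \<noteq> gx" "e' \<noteq> gy" by blast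
  have "e \<inter> e' = {}" using e' g xy pm_edge_eq[OF pm(2), of e'] by blast
  then obtain N where N: "pm V N" "e \<in> N" "e' \<in> N" "N \<inter> M'' \<subseteq> {e, e'}"
    using pm_extend_two_edges[OF V(1,2) \<open>card V \<ge> 8\<close> e2, of e' M''] e' pm_card_edge[OF pm(2)]
      pm_edge_subset[OF pm(2)] pm_imp_matching[OF pm(3)] by blast
  then have "N \<inter> M'' \<noteq> {}" using line_meets(1)[OF l N(1)] e e' by blast
  then have "e \<in> M'' \<or> e' \<in> M''" using N by blast
  then show False using sub2 sub3 e e' by blast
qed

text \<open>Let \<open>M - M' = {e1, e2}\<close> with \<open>e1\<close> in \<open>N\<close>. An edge
  of \<open>N\<close> in \<open>M'\<close> but not in \<open>M\<close> can touch neither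
  \<open>e1\<close> nor an edge of \<open>M \<inter> M'\<close>, so it fills \<open>e2\<close> and
  would equal it. Thus disjointness from \<open>M'\<close> tells where \<open>N\<close> meets
  \<open>M\<close>.\<close>

lemma meets_iff_subset_diff:
  assumes V: "finite V" and pm: "pm V M" "pm V M'" "pm V N" and c: "card (M - M') = 2" and meet: "N \<inter> M \<noteq> {}"
  shows "N \<inter> M' = {} \<longleftrightarrow> N \<inter> M \<subseteq> M - M'"
proof
  assume sub: "N \<inter> M \<subseteq> M - M'"
  obtain e1 where e1: "e1 \<in> N" "e1 \<in> M" using meet by blast
  then have "e1 \<in> M - M'" using sub by blast
  then obtain e2 where e2: "M - M' = {e1, e2}"
    using c unfolding card_2_iff by (elim exE conjE) (metis insertE insert_commute singletonD)
  show "N \<inter> M' = {}"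
  proof (rule ccontr)
    assume "N \<inter> M' \<noteq> {}"
    then obtain g where g: "g \<in> N" "g \<in> M'" by blast
    then have gM: "g \<notin> M" using sub by blast
    have "g \<subseteq> e2"
    proof
      fix x assume x: "x \<in> g"
      then have "x \<in> V" using g pm_edge_subset[OF pm(2)] by blast
      then obtain h where h: "h \<in> M" "x \<in> h" using pm_cover[OF pm(1)] by blast
      then have "h \<notin> M'" using pm_edge_eq[OF pm(2) _ g(2), of h x] x gM by blast
      moreover have "h \<noteq> e1" using pm_edge_eq[OF pm(3) e1(1) g(1), of x] x gM e1 h by blast
      ultimately show "x \<in> e2" using h e2 by blast
    qed
    moreover have "card e2 = 2" using e2 pm_card_edge[OF pm(1)] by blast
    ultimately have "g = e2" using pm_card_edge[OF pm(2) g(2)] card2_subset_eq by blast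
    then show False using gM e2 by blast
  qed
qed blast

text \<open>Keep the rest \<open>R\<close> of \<open>M\<close> and rematch the four endpoints in the
  two other ways. No matching meets two of the three matchings of the four points, so one that meets
  two members of the triple either meets \<open>R\<close> or is impossible; in the former case it
  meets the third.\<close>

lemma line_exists:
  assumes V: "finite V" "card V \<ge> 6" and M: "pm V M" and e: "e \<in> M" "e' \<in> M" "e \<noteq> e'"
  shows "\<exists>M' M''. line V M M' M'' \<and> M - M' = {e, e'}"
proof -
  obtain a b where ab: "e = {a, b}" "a \<noteq> b" using pm_card_edge[OF M e(1)] by (auto simp: card_2_iff)
  obtain c d where cd: "e' = {c, d}" "c \<noteq> d" using pm_card_edge[OF M e(2)] by (auto simp: card_2_iff)
  have disj: "e \<inter> e' = {}" using pm_edge_eq[OF M e(1,2)] e(3) by blast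
  then have dist: "distinct [a, b, c, d]" using ab cd by auto
  define R where "R = M - {e, e'}"
  let ?Q = "{a, b, c, d}"
  have Q: "\<Union>{e, e'} = ?Q" using ab cd by auto
  have R: "pm (V - ?Q) R" using pm_diff[OF M, of "{e, e'}"] e Q by (simp add: R_def)
  have QV: "?Q \<subseteq> V" using pm_edge_subset[OF M e(1)] pm_edge_subset[OF M e(2)] ab cd by auto
  define F where "F = {{a, c}, {b, d}}"
  define G where "G = {{a, d}, {b, c}}"
  have "{a, c, b, d} = ?Q" "{a, d, b, c} = ?Q" by auto
  then have F: "pm ?Q F" and G: "pm ?Q G"
    using pm_quad[of a c b d] pm_quad[of a d b c] dist by (auto simp: F_def G_def)
  have un: "pm V (X \<union> R)" if "pm ?Q X" for X
    using pm_Un[OF that R] QV by (metis Diff_disjoint Diff_partition)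
  have fin: "finite M" using pm_finite V M by blast
  have RM: "M = {e, e'} \<union> R" using e by (auto simp: R_def)
  \<comment> \<open>Three edges are needed for \<open>R\<close> to be nonempty, so that the three
    matchings intersect pairwise.\<close>
  have "card M \<ge> 3" using pm_card[OF V(1) M] V(2) by simp
  moreover have "card {e, e'} = 2" using e by simp
  ultimately have "R \<noteq> {}" using RM by auto
  have noR: "f \<notin> R" if "f \<in> F \<union> G \<union> {e, e'}" for f
  proof
    assume "f \<in> R" then have "f \<subseteq> V - ?Q" "card f = 2" using pm_edge_subset[OF R] pm_card_edge[OF R] by auto
    moreover have "f \<subseteq> ?Q" using that ab cd by (auto simp: F_def G_def)
    ultimately have "f = {}" by blast
    with \<open>card f = 2\<close> show False by simp
  qed
  have cross: "f \<inter> g \<noteq> {} \<and> f \<noteq> g" if "f \<in> {e, e'} \<and> g \<in> F \<or> f \<in> {e, e'} \<and> g \<in> G \<or> f \<in> F \<and> g \<in> G" for f g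
    using that dist unfolding ab cd F_def G_def
    by (elim disjE conjE insertE emptyE; hypsubst; simp add: doubleton_eq_iff; metis)
  have no: "\<not> (N \<inter> X \<noteq> {} \<and> N \<inter> Y \<noteq> {})" if N: "pm V N" and
    "X = {e, e'} \<and> Y = F \<or> X = {e, e'} \<and> Y = G \<or> X = F \<and> Y = G" for N X Y
  proof
    assume "N \<inter> X \<noteq> {} \<and> N \<inter> Y \<noteq> {}"
    then obtain f g where fg: "f \<in> N" "g \<in> N" "f \<in> X" "g \<in> Y" by blast
    then have "f \<inter> g \<noteq> {} \<and> f \<noteq> g" using that(2) by (intro cross) blast
    then show False using pm_edge_eq[OF N fg(1,2)] by blast
  qed
  have diff: "M - (F \<union> R) = {e, e'}"
  proof -
    have "e \<notin> F" "e' \<notin> F" using cross[of e e] cross[of e' e'] by blast+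
    then show ?thesis using noR[of e] noR[of e'] RM by auto
  qed
  have "line V M (F \<union> R) (G \<union> R)"
    unfolding line_def
  proof (intro conjI allI impI)
    show "M \<noteq> F \<union> R" using diff by auto
    fix N assume N: "pm V N"
    note n = no[OF N, of "{e, e'}" F] no[OF N, of "{e, e'}" G] no[OF N, of F G]
    show "N \<inter> (G \<union> R) \<noteq> {}" if "N \<inter> M \<noteq> {}" "N \<inter> (F \<union> R) \<noteq> {}" using that n(1) RM by auto
    show "N \<inter> (F \<union> R) \<noteq> {}" if "N \<inter> M \<noteq> {}" "N \<inter> (G \<union> R) \<noteq> {}" using that n(2) RM by auto
    show "N \<inter> M \<noteq> {}" if "N \<inter> (F \<union> R) \<noteq> {}" "N \<inter> (G \<union> R) \<noteq> {}" using that n(3) RM by auto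
  qed (use M un F G \<open>R \<noteq> {}\<close> RM in auto)
  then show ?thesis using diff by blast
qed

text \<open>If \<open>A\<close> and \<open>B\<close> lie on two different lines through \<open>M\<close>, a matching that meets \<open>M\<close> but neither
  \<open>A\<close> nor \<open>B\<close> meets \<open>M\<close> in just the one edge common to the pairs \<open>M - A\<close> and \<open>M - B\<close>; the matching
  \<open>Z\<close> witnesses that these two pairs differ.\<close>

definition same_edge :: "'a set \<Rightarrow> 'a set set \<Rightarrow> 'a set set \<Rightarrow> 'a set set \<Rightarrow> bool" where
  "same_edge V M N P \<longleftrightarrow> (\<exists>A A' B B' Z. line V M A A' \<and> line V M B B'
     \<and> pm V Z \<and> Z \<inter> M \<noteq> {} \<and> Z \<inter> A = {} \<and> Z \<inter> B \<noteq> {}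
     \<and> N \<inter> M \<noteq> {} \<and> N \<inter> A = {} \<and> N \<inter> B = {} \<and> P \<inter> M \<noteq> {} \<and> P \<inter> A = {} \<and> P \<inter> B = {})"

text \<open>Two different pairs of edges share at most one edge, which gives the forward direction.
  For the converse, take further edges \<open>f\<close> and \<open>g\<close> of \<open>M\<close>,
  lines for the pairs \<open>{e, f}\<close> and \<open>{e, g}\<close>, and for \<open>Z\<close> a
  matching that meets \<open>M\<close> only in \<open>f\<close>.\<close>

lemma same_edge_iff:
  assumes V: "finite V" "even (card V)" "card V \<ge> 6" and pm: "pm V M" "pm V N" "pm V P"
  shows "same_edge V M N P \<longleftrightarrow> (\<exists>e. M \<inter> N = {e} \<and> M \<inter> P = {e})"
proof
  assume "same_edge V M N P"
  then obtain A A' B B' Z where l: "line V M A A'" "line V M B B'"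
    and Z: "pm V Z" "Z \<inter> M \<noteq> {}" "Z \<inter> A = {}" "Z \<inter> B \<noteq> {}"
    and N: "N \<inter> M \<noteq> {}" "N \<inter> A = {}" "N \<inter> B = {}"
    and P: "P \<inter> M \<noteq> {}" "P \<inter> A = {}" "P \<inter> B = {}"
    unfolding same_edge_def by (elim exE conjE) (rule that; assumption)
  have pmAB: "pm V A" "pm V B" using l line_pm(2) by blast+
  note c = line_card_diff[OF V l(1)] line_card_diff[OF V l(2)]
  note i = meets_iff_subset_diff[OF V(1) pm(1) pmAB(1) _ c(1)] meets_iff_subset_diff[OF V(1) pm(1) pmAB(2) _ c(2)]
  have "M - A \<noteq> M - B" using i(1)[OF Z(1,2)] i(2)[OF Z(1,2)] Z(3,4) by auto
  moreover have N': "N \<inter> M \<subseteq> (M - A) \<inter> (M - B)" using i(1)[OF pm(2) N(1)] i(2)[OF pm(2) N(1)] N(2,3) by auto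
  moreover have P': "P \<inter> M \<subseteq> (M - A) \<inter> (M - B)" using i(1)[OF pm(3) P(1)] i(2)[OF pm(3) P(1)] P(2,3) by auto
  moreover obtain e where e: "e \<in> N \<inter> M" using N by blast
  moreover have "X \<inter> Y \<subseteq> {e}" if "card X = 2" "card Y = 2" "X \<noteq> Y" "e \<in> X \<inter> Y" for X Y :: "'a set set"
    using that by (auto simp: card_2_iff doubleton_eq_iff)
  ultimately have "(M - A) \<inter> (M - B) \<subseteq> {e}" using c by blast
  then show "\<exists>e. M \<inter> N = {e} \<and> M \<inter> P = {e}" using N' P' e P(1) by blast
next
  assume "\<exists>e. M \<inter> N = {e} \<and> M \<inter> P = {e}"
  then obtain e where e: "M \<inter> N = {e}" "M \<inter> P = {e}" by blast
  have "card M \<ge> 3" using pm_card[OF V(1) pm(1)] V(3) by simp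
  have "card (M - {e}) \<ge> 2" using \<open>card M \<ge> 3\<close> e pm_finite[OF V(1) pm(1)] by (subst card_Diff_singleton) auto
  then obtain S where "S \<subseteq> M - {e}" "card S = 2" by (meson obtain_subset_with_card_n)
  then obtain f g where fg: "f \<in> M" "g \<in> M" "f \<noteq> e" "g \<noteq> e" "f \<noteq> g" by (auto simp: card_2_iff)
  have eM: "e \<in> M" using e by auto
  obtain A A' where A: "line V M A A'" "M - A = {e, f}" using line_exists[OF V(1,3) pm(1) eM fg(1)] fg by blast
  obtain B B' where B: "line V M B B'" "M - B = {e, g}" using line_exists[OF V(1,3) pm(1) eM fg(2)] fg by blast
  have pmAB: "pm V A" "pm V B" using A(1) B(1) line_pm(2) by blast+
  note c = line_card_diff[OF V A(1)] line_card_diff[OF V B(1)]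
  note i = meets_iff_subset_diff[OF V(1) pm(1) pmAB(1) _ c(1)] meets_iff_subset_diff[OF V(1) pm(1) pmAB(2) _ c(2)]
  obtain Z where Z: "pm V Z" "f \<in> Z" "Z \<inter> M \<subseteq> {f}"
    using pm_extend_edge[OF V pm_card_edge[OF pm(1) fg(1)] pm_edge_subset[OF pm(1) fg(1)], of M M] pm_imp_matching[OF pm(1)] by blast
  have Z2: "Z \<inter> M \<noteq> {}" using Z fg by blast
  have "Z \<inter> A = {}" using i(1)[OF Z(1) Z2] A Z by blast
  moreover have "Z \<inter> B \<noteq> {}" using i(2)[OF Z(1) Z2] B Z fg by blast
  moreover have NM: "N \<inter> M = {e}" "P \<inter> M = {e}" using e by auto
  moreover have "N \<inter> A = {}" "N \<inter> B = {}" using i(1)[OF pm(2)] i(2)[OF pm(2)] NM A B by auto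
  moreover have "P \<inter> A = {}" "P \<inter> B = {}" using i(1)[OF pm(3)] i(2)[OF pm(3)] NM A B by auto
  ultimately show "same_edge V M N P" unfolding same_edge_def using A(1) B(1) Z(1) Z2
    by (intro exI[of _ A] exI[of _ A'] exI[of _ B] exI[of _ B'] exI[of _ Z]) simp
qed

section \<open>Automorphisms come from vertex permutations\<close>

text \<open>The inverse is part of the data, so exchanging the two maps gives the inverse
  automorphism. Adjacency is disjointness, hence the second condition.\<close>

definition pm_aut :: "'a set \<Rightarrow> ('a set set \<Rightarrow> 'a set set) \<Rightarrow> ('a set set \<Rightarrow> 'a set set) \<Rightarrow> bool" where
  "pm_aut V \<phi> \<phi>' \<longleftrightarrow>
    (\<forall>M. pm V M \<longrightarrow> pm V (\<phi> M) \<and> pm V (\<phi>' M) \<and> \<phi>' (\<phi> M) = M \<and> \<phi> (\<phi>' M) = M)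
    \<and> (\<forall>M N. pm V M \<longrightarrow> pm V N \<longrightarrow> (\<phi> M \<inter> \<phi> N = {} \<longleftrightarrow> M \<inter> N = {}))"

lemma pm_autD:
  assumes "pm_aut V \<phi> \<phi>'" "pm V M"
  shows "pm V (\<phi> M)" "pm V (\<phi>' M)" "\<phi>' (\<phi> M) = M" "\<phi> (\<phi>' M) = M"
  using assms by (simp_all add: pm_aut_def)

lemma pm_aut_disjoint: "pm_aut V \<phi> \<phi>' \<Longrightarrow> pm V M \<Longrightarrow> pm V N \<Longrightarrow> \<phi> M \<inter> \<phi> N = {} \<longleftrightarrow> M \<inter> N = {}"
  by (simp add: pm_aut_def)

lemma pm_aut_inverse: "pm_aut V \<phi> \<phi>' \<Longrightarrow> pm_aut V \<phi>' \<phi>"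
  unfolding pm_aut_def by metis

lemma pm_aut_line:
  assumes aut: "pm_aut V \<phi> \<phi>'" and l: "line V M M' M''"
  shows "line V (\<phi> M) (\<phi> M') (\<phi> M'')"
proof -
  note pm = line_pm[OF l]
  have ne: "M \<noteq> M'" "M \<inter> M' \<noteq> {}" "M \<inter> M'' \<noteq> {}" "M' \<inter> M'' \<noteq> {}" using l by (auto simp: line_def)
  \<comment> \<open>The test matchings of a line range over all perfect matchings and are pulled
    back along \<open>\<phi>'\<close>.\<close>
  have d: "N \<inter> \<phi> X = {} \<longleftrightarrow> \<phi>' N \<inter> X = {}" if "pm V N" "pm V X" for N X
    using pm_aut_disjoint[OF aut, of "\<phi>' N" X] pm_autD[OF aut] that by simp
  show ?thesis unfolding line_def
  proof (intro conjI allI impI)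
    show "\<phi> M \<noteq> \<phi> M'" using pm_autD(3)[OF aut] pm ne(1) by metis
    fix N assume N: "pm V N"
    note lm = line_meets[OF l pm_autD(2)[OF aut N]]
    show "N \<inter> \<phi> M'' \<noteq> {}" if "N \<inter> \<phi> M \<noteq> {}" "N \<inter> \<phi> M' \<noteq> {}"
      using that lm(1) d[OF N] pm by simp
    show "N \<inter> \<phi> M' \<noteq> {}" if "N \<inter> \<phi> M \<noteq> {}" "N \<inter> \<phi> M'' \<noteq> {}"
      using that lm(2) d[OF N] pm by simp
    show "N \<inter> \<phi> M \<noteq> {}" if "N \<inter> \<phi> M' \<noteq> {}" "N \<inter> \<phi> M'' \<noteq> {}"
      using that lm(3) d[OF N] pm by simp
  qed (use pm pm_autD(1)[OF aut] pm_aut_disjoint[OF aut] ne in auto)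
qed

lemma pm_aut_same_edge:
  assumes aut: "pm_aut V \<phi> \<phi>'" and pm: "pm V M" "pm V N" "pm V P" and s: "same_edge V M N P"
  shows "same_edge V (\<phi> M) (\<phi> N) (\<phi> P)"
proof -
  obtain A A' B B' Z where l: "line V M A A'" "line V M B B'"
    and Z: "pm V Z" "Z \<inter> M \<noteq> {}" "Z \<inter> A = {}" "Z \<inter> B \<noteq> {}"
    and N: "N \<inter> M \<noteq> {}" "N \<inter> A = {}" "N \<inter> B = {}"
    and P: "P \<inter> M \<noteq> {}" "P \<inter> A = {}" "P \<inter> B = {}"
    using s unfolding same_edge_def by (elim exE conjE) (rule that; assumption)
  note pmAB = line_pm(2)[OF l(1)] line_pm(2)[OF l(2)]
  note d = pm_aut_disjoint[OF aut]
  show ?thesis unfolding same_edge_def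
    using pm_aut_line[OF aut l(1)] pm_aut_line[OF aut l(2)] pm_autD(1)[OF aut Z(1)]
      d[OF Z(1) pm(1)] d[OF Z(1) pmAB(1)] d[OF Z(1) pmAB(2)] Z
      d[OF pm(2) pm(1)] d[OF pm(2) pmAB(1)] d[OF pm(2) pmAB(2)] N
      d[OF pm(3) pm(1)] d[OF pm(3) pmAB(1)] d[OF pm(3) pmAB(2)] P
    by (intro exI[of _ "\<phi> A"] exI[of _ "\<phi> A'"] exI[of _ "\<phi> B"] exI[of _ "\<phi> B'"] exI[of _ "\<phi> Z"]) simp
qed

lemma pm_aut_meet_eq:
  assumes V: "finite V" "even (card V)" "card V \<ge> 6" and aut: "pm_aut V \<phi> \<phi>'"
    and pm: "pm V M" "pm V N" "pm V P" and e: "M \<inter> N = {e}" "M \<inter> P = {e}"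
  shows "\<exists>e'. \<phi> M \<inter> \<phi> N = {e'} \<and> \<phi> M \<inter> \<phi> P = {e'}"
  using pm_aut_same_edge[OF aut pm] same_edge_iff[OF V pm] e
    same_edge_iff[OF V pm_autD(1)[OF aut pm(1)] pm_autD(1)[OF aut pm(2)] pm_autD(1)[OF aut pm(3)]]
  by auto

text \<open>The image of an edge is read off from any two matchings that meet exactly in it.
  Independence of the choice: a matching \<open>Q\<close> through \<open>e\<close> that meets
  \<open>M\<close> and \<open>M1\<close> only in \<open>e\<close> links the two choices, by
  replacing one matching of the pair at a time.\<close>

lemma pm_aut_edge_map:
  assumes V: "finite V" "even (card V)" "card V \<ge> 6" and aut: "pm_aut V \<phi> \<phi>'"
  shows "\<exists>\<psi>. \<forall>e M N. pm V M \<longrightarrow> pm V N \<longrightarrow> M \<inter> N = {e} \<longrightarrow> \<phi> M \<inter> \<phi> N = {\<psi> e}"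
proof -
  have "\<exists>e'. \<forall>M N. pm V M \<longrightarrow> pm V N \<longrightarrow> M \<inter> N = {e} \<longrightarrow> \<phi> M \<inter> \<phi> N = {e'}" for e
  proof (cases "\<exists>M N. pm V M \<and> pm V N \<and> M \<inter> N = {e}")
    case True
    then obtain M N where M: "pm V M" and N: "pm V N" and MN: "M \<inter> N = {e}" by blast
    obtain e' where e': "\<phi> M \<inter> \<phi> N = {e'}" using pm_aut_meet_eq[OF V aut M N N MN MN] by blast
    have "\<phi> M1 \<inter> \<phi> N1 = {e'}" if M1: "pm V M1" and N1: "pm V N1" and MN1: "M1 \<inter> N1 = {e}" for M1 N1
    proof -
      have eM: "e \<in> M" "e \<in> M1" using MN MN1 by auto
      obtain Q where Q: "pm V Q" "e \<in> Q" "Q \<inter> M \<subseteq> {e}" "Q \<inter> M1 \<subseteq> {e}"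
        using pm_extend_edge[OF V pm_card_edge[OF M eM(1)] pm_edge_subset[OF M eM(1)]]
          pm_imp_matching M M1 by blast
      then have QM: "Q \<inter> M = {e}" "M \<inter> Q = {e}" "Q \<inter> M1 = {e}" "M1 \<inter> Q = {e}" using eM by auto
      show ?thesis
        using pm_aut_meet_eq[OF V aut M N Q(1) MN QM(2)] pm_aut_meet_eq[OF V aut Q(1) M M1 QM(1,3)]
          pm_aut_meet_eq[OF V aut M1 Q(1) N1 QM(4) MN1] e' by (auto simp: Int_commute)
    qed
    then show ?thesis by blast
  next
    case False
    then have "\<And>M N. pm V M \<Longrightarrow> pm V N \<Longrightarrow> M \<inter> N = {e} \<Longrightarrow> False" by blast
    \<comment> \<open>If \<open>e\<close> never arises as an intersection, every value satisfies the
      condition.\<close>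
    then show ?thesis by (intro exI[of _ undefined]) auto
  qed
  then show ?thesis by metis
qed

section \<open>From the action on edges to the action on vertices\<close>

lemma intersecting_edges_common_vertex:
  assumes F: "\<And>e. e \<in> F \<Longrightarrow> card e = 2" and int: "\<And>e f. e \<in> F \<Longrightarrow> f \<in> F \<Longrightarrow> e \<inter> f \<noteq> {}"
    and c: "card F \<ge> 4"
  shows "\<exists>v. \<forall>e\<in>F. v \<in> e"
proof (rule ccontr)
  assume no: "\<nexists>v. \<forall>e\<in>F. v \<in> e"
  obtain e where e: "e \<in> F" using c by fastforce
  obtain a b where ab: "e = {a, b}" "a \<noteq> b" using F[OF e] by (auto simp: card_2_iff)
  obtain f where f: "f \<in> F" "a \<notin> f" using no by blast
  then have bf: "b \<in> f" using int[OF e f(1)] ab by auto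
  then obtain c where c': "f = {b, c}" "c \<noteq> b" using F[OF f(1)] unfolding card_2_iff by fastforce
  obtain g where g: "g \<in> F" "b \<notin> g" using no by blast
  \<comment> \<open>Without a common vertex, \<open>e\<close>, \<open>f\<close> and \<open>g\<close>
    form a triangle, and an edge meeting all three sides is one of them. A triangle has too few
    edges.\<close>
  have "h = e \<or> h = f \<or> h = {a, c}" if h: "h \<in> F" for h
  proof -
    have "a \<in> g" "c \<in> g" using int[OF e g(1)] int[OF f(1) g(1)] g ab c' by auto
    moreover have "a \<noteq> c" using f c' by auto
    ultimately have "g = {a, c}" using card2_eq F[OF g(1)] by metis
    then have "a \<in> h \<or> b \<in> h" "b \<in> h \<or> c \<in> h" "a \<in> h \<or> c \<in> h"
      using int[OF h e] int[OF h f(1)] int[OF h g(1)] ab c' by auto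
    then show ?thesis using card2_eq[OF F[OF h]] ab c' \<open>a \<noteq> c\<close> by metis
  qed
  then have "F \<subseteq> {e, f, {a, c}}" by blast
  then have "card F \<le> card {e, f, {a, c}}" by (intro card_mono) auto
  also have "\<dots> \<le> 3" using card_length[of "[e, f, {a, c}]"] by simp
  finally show False using c by simp
qed

lemma pm_contains_disjoint_edges:
  assumes "finite V" "even (card V)" "card e = 2" "e \<subseteq> V" "card f = 2" "f \<subseteq> V" "e \<inter> f = {}"
  shows "\<exists>M. pm V M \<and> e \<in> M \<and> f \<in> M"
proof -
  have fin: "finite e" "finite f" using assms finite_subset by blast+
  have "card (V - e) = card V - 2" "card (V - e - f) = card (V - e) - 2"
    using assms fin by (auto simp: card_Diff_subset intro!: card_Diff_subset[THEN trans])
  then have "even (card (V - e - f))" using assms(2) by simp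
  then obtain M where "pm (V - e - f) M" using pm_exists[of "V - e - f"] assms(1) by blast
  then have "pm V (insert e (insert f M))" using assms by (intro pm_insert) auto
  then show ?thesis by blast
qed

lemma pm_image:
  assumes "bij_betw p V W" "pm V M" shows "pm W ((`) p ` M)"
proof -
  have inj: "inj_on p V" and im: "p ` V = W" using assms(1) by (auto simp: bij_betw_def)
  note sub = pm_edge_subset[OF assms(2)]
  show ?thesis
  proof (rule pmI)
    fix e assume "e \<in> (`) p ` M"
    then obtain g where g: "g \<in> M" "e = p ` g" by blast
    then show "card e = 2" using card_image[OF inj_on_subset[OF inj sub]] pm_card_edge[OF assms(2)] by simp
    show "e \<subseteq> W" using sub g im by blast
  next
    fix v assume "v \<in> W"
    then obtain u where u: "u \<in> V" "v = p u" using im by blast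
    obtain h where "h \<in> M" "u \<in> h" using pm_cover[OF assms(2) u(1)] by (rule bexE)
    then show "\<exists>e\<in>(`) p ` M. v \<in> e"
      using u by (intro bexI[of _ "p ` h"]) simp_all
  next
    fix e e' x assume e: "e \<in> (`) p ` M" and e': "e' \<in> (`) p ` M" and x: "x \<in> e" "x \<in> e'"
    obtain g where g: "g \<in> M" "e = p ` g" using e by (rule imageE)
    obtain g' where g': "g' \<in> M" "e' = p ` g'" using e' by (rule imageE)
    obtain y where y: "x = p y" "y \<in> g" using x(1) unfolding g(2) by (rule imageE)
    obtain y' where y': "x = p y'" "y' \<in> g'" using x(2) unfolding g'(2) by (rule imageE)
    note * = g g' y y'
    then have "y = y'" using inj_onD[OF inj, of y y'] sub[of g] sub[of g'] * by auto
    then show "e = e'" using pm_edge_eq[OF assms(2), of g g' y] * by simp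
  qed
qed

text \<open>The edge maps of \<open>\<phi>\<close> and \<open>\<phi>'\<close> invert each other,
  whence injectivity. If incident edges had disjoint images, these images would lie in one perfect
  matching, and its image under \<open>\<phi>'\<close> would contain both original edges, so they
  would coincide.\<close>

lemma pm_aut_edge_perm:
  assumes V: "finite V" "even (card V)" "card V \<ge> 6" and aut: "pm_aut V \<phi> \<phi>'"
  shows "\<exists>\<psi>. inj_on \<psi> {e. e \<subseteq> V \<and> card e = 2} \<and> (\<forall>M. pm V M \<longrightarrow> \<psi> ` M \<subseteq> \<phi> M)
    \<and> (\<forall>e f. e \<subseteq> V \<longrightarrow> card e = 2 \<longrightarrow> f \<subseteq> V \<longrightarrow> card f = 2 \<longrightarrow> e \<inter> f \<noteq> {} \<longrightarrow> \<psi> e \<inter> \<psi> f \<noteq> {})"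
proof -
  note aut' = pm_aut_inverse[OF aut]
  obtain \<psi> where \<psi>: "\<And>e M N. pm V M \<Longrightarrow> pm V N \<Longrightarrow> M \<inter> N = {e} \<Longrightarrow> \<phi> M \<inter> \<phi> N = {\<psi> e}"
    using pm_aut_edge_map[OF V aut] by blast
  obtain \<psi>' where \<psi>': "\<And>e M N. pm V M \<Longrightarrow> pm V N \<Longrightarrow> M \<inter> N = {e} \<Longrightarrow> \<phi>' M \<inter> \<phi>' N = {\<psi>' e}"
    using pm_aut_edge_map[OF V aut'] by blast
  have single: "\<exists>N. pm V N \<and> M \<inter> N = {e}" if "pm V M" "e \<in> M" for M e
    using pm_extend_edge[OF V pm_card_edge[OF that] pm_edge_subset[OF that], of M M]
      pm_imp_matching[OF that(1)] that(2) by blast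
  have mem: "\<psi> e \<in> \<phi> M" if M: "pm V M" "e \<in> M" for M e
    using single[OF M] \<psi>[OF M(1)] by blast
  have mem': "\<psi>' e \<in> \<phi>' M" if "pm V M" "e \<in> M" for M e
    using single[OF that] \<psi>'[OF that(1)] by blast
  have ex: "\<exists>M. pm V M \<and> e \<in> M" if "e \<subseteq> V" "card e = 2" for e
    using pm_extend_edge[OF V that(2,1), of "{}" "{}"] by (auto simp: matching_def)
  have inv: "\<psi>' (\<psi> e) = e" if e: "e \<subseteq> V" "card e = 2" for e
  proof -
    obtain M where M: "pm V M" "e \<in> M" using ex[OF e] by blast
    obtain N where N: "pm V N" "M \<inter> N = {e}" using single[OF M] by blast
    have "\<phi>' (\<phi> M) \<inter> \<phi>' (\<phi> N) = {\<psi>' (\<psi> e)}"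
      using \<psi>'[OF pm_autD(1)[OF aut M(1)] pm_autD(1)[OF aut N(1)] \<psi>[OF M(1) N]] .
    then show ?thesis using N pm_autD(3)[OF aut] M(1) by simp
  qed
  have "\<psi> e \<inter> \<psi> f \<noteq> {}" if e: "e \<subseteq> V" "card e = 2" and f: "f \<subseteq> V" "card f = 2" and ef: "e \<inter> f \<noteq> {}" for e f
  proof
    assume disj: "\<psi> e \<inter> \<psi> f = {}"
    have E: "\<psi> g \<subseteq> V" "card (\<psi> g) = 2" if g: "g \<subseteq> V" "card g = 2" for g
    proof -
      obtain M where M: "pm V M" "g \<in> M" using ex[OF g] by blast
      show "\<psi> g \<subseteq> V" "card (\<psi> g) = 2"
        using pm_edge_subset[OF pm_autD(1)[OF aut M(1)] mem[OF M]] pm_card_edge[OF pm_autD(1)[OF aut M(1)] mem[OF M]] .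
    qed
    obtain N where N: "pm V N" "\<psi> e \<in> N" "\<psi> f \<in> N"
      using pm_contains_disjoint_edges[OF V(1,2) E(2)[OF e] E(1)[OF e] E(2)[OF f] E(1)[OF f] disj] by blast
    have "e \<in> \<phi>' N" "f \<in> \<phi>' N" using mem'[OF N(1,2)] mem'[OF N(1,3)] inv[OF e] inv[OF f] by simp_all
    then have "e = f" using pm_edge_eq[OF pm_autD(2)[OF aut N(1)], of e f] ef by blast
    then show False using disj E(2)[OF e] by auto
  qed
  moreover have "inj_on \<psi> {e. e \<subseteq> V \<and> card e = 2}" using inv by (intro inj_on_inverseI[of _ \<psi>']) auto
  ultimately show ?thesis using mem by (intro exI[of _ \<psi>]) blast
qed

text \<open>The star \<open>S a\<close> of all edges at \<open>a\<close> is sent to pairwise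
  intersecting edges, too many for a triangle; so they share a vertex \<open>q a\<close>. The edge
  \<open>{a, b}\<close> then goes to \<open>{q a, q b}\<close>.\<close>

lemma pm_aut_vertex_perm:
  assumes V: "finite V" "even (card V)" "card V \<ge> 6" and aut: "pm_aut V \<phi> \<phi>'"
  shows "\<exists>p. p permutes V \<and> (\<forall>M. pm V M \<longrightarrow> \<phi> M = (`) p ` M)"
proof -
  let ?E = "{e. e \<subseteq> V \<and> card e = 2}"
  obtain \<psi> where \<psi>: "inj_on \<psi> ?E \<and> (\<forall>M. pm V M \<longrightarrow> \<psi> ` M \<subseteq> \<phi> M)
    \<and> (\<forall>e f. e \<subseteq> V \<longrightarrow> card e = 2 \<longrightarrow> f \<subseteq> V \<longrightarrow> card f = 2 \<longrightarrow> e \<inter> f \<noteq> {} \<longrightarrow> \<psi> e \<inter> \<psi> f \<noteq> {})"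
    using pm_aut_edge_perm[OF V aut] by (rule exE)
  then have inj: "inj_on \<psi> ?E" by simp
  from \<psi> have mem: "\<psi> e \<in> \<phi> M" if "pm V M" "e \<in> M" for M e
    using that by (simp add: image_subset_iff)
  have int: "\<psi> e \<inter> \<psi> f \<noteq> {}" if "e \<in> ?E" "f \<in> ?E" "e \<inter> f \<noteq> {}" for e f
    using \<psi> that by simp
  have E: "\<psi> e \<in> ?E" if e: "e \<in> ?E" for e
  proof -
    obtain M where M: "pm V M" "e \<in> M"
      using pm_extend_edge[OF V, of e "{}" "{}"] e by (auto simp: matching_def)
    then show ?thesis
      using mem[OF M] pm_edge_subset[OF pm_autD(1)[OF aut M(1)]] pm_card_edge[OF pm_autD(1)[OF aut M(1)]] by blast
  qed
  define S where "S a = (\<lambda>x. {a, x}) ` (V - {a})" for a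
  have SE: "S a \<subseteq> ?E" if "a \<in> V" for a using that by (auto simp: S_def)
  have cS: "card (S a) = card V - 1" if "a \<in> V" for a
  proof -
    have "inj_on (\<lambda>x. {a, x}) (V - {a})" by (auto simp: inj_on_def doubleton_eq_iff)
    then show ?thesis using that V(1) by (simp add: S_def card_image)
  qed
  have "\<exists>v. \<forall>e\<in>\<psi> ` S a. v \<in> e" if a: "a \<in> V" for a
  proof (rule intersecting_edges_common_vertex)
    have "card (\<psi> ` S a) = card V - 1" using card_image[OF inj_on_subset[OF inj SE[OF a]]] cS[OF a] by simp
    then show "card (\<psi> ` S a) \<ge> 4" using V(3) by simp
    show "card e = 2" if "e \<in> \<psi> ` S a" for e using that SE[OF a] E by blast
    show "e \<inter> f \<noteq> {}" if ef: "e \<in> \<psi> ` S a" "f \<in> \<psi> ` S a" for e f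
    proof -
      obtain e' f' where *: "e' \<in> S a" "f' \<in> S a" "e = \<psi> e'" "f = \<psi> f'" using ef by blast
      moreover have "e' \<inter> f' \<noteq> {}" using * by (auto simp: S_def)
      ultimately show ?thesis using int SE[OF a] by blast
    qed
  qed
  then obtain q where q: "\<And>a e. a \<in> V \<Longrightarrow> e \<in> S a \<Longrightarrow> q a \<in> \<psi> e" by (metis imageI)
  have q2: "q a \<in> \<psi> {a, b}" "q b \<in> \<psi> {a, b}" if "a \<in> V" "b \<in> V" "a \<noteq> b" for a b
    using that q[of a "{a, b}"] q[of b "{a, b}"] by (auto simp: S_def insert_commute)
  have qV: "q ` V \<subseteq> V"
  proof
    fix y assume "y \<in> q ` V"
    then obtain a where a: "a \<in> V" "y = q a" by blast
    have "\<not> V \<subseteq> {a}" using V(3) card_mono[of "{a}" V] by auto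
    then obtain b where b: "b \<in> V" "b \<noteq> a" by blast
    then have "{a, b} \<in> ?E" using a by auto
    then have "\<psi> {a, b} \<subseteq> V" using E by blast
    then show "y \<in> V" using q2(1)[OF a(1) b(1)] a b by auto
  qed
  have "inj_on q V"
  \<comment> \<open>If \<open>q a = q b\<close>, the star at \<open>a\<close> together with one
    further edge at \<open>b\<close> would be mapped injectively into the star at
    \<open>q a\<close>, which has one edge fewer.\<close>
  proof (rule inj_onI, rule ccontr)
    fix a b assume ab: "a \<in> V" "b \<in> V" "q a = q b" "a \<noteq> b"
    have "\<not> V \<subseteq> {a, b}" using V(3) card_mono[of "{a, b}" V] ab(4) by auto
    then obtain x where x: "x \<in> V" "x \<noteq> a" "x \<noteq> b" by blast
    let ?T = "insert {b, x} (S a)"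
    have xb: "{b, x} \<in> S b" using x by (auto simp: S_def)
    have "{b, x} \<notin> S a" using ab x by (auto simp: S_def doubleton_eq_iff)
    then have "card ?T = card V"
      using cS[OF ab(1)] V by (subst card_insert_disjoint) (auto simp: S_def)
    moreover have TE: "?T \<subseteq> ?E" using SE[OF ab(1)] SE[OF ab(2)] xb by blast
    ultimately have "card (\<psi> ` ?T) = card V" using card_image[OF inj_on_subset[OF inj TE]] by simp
    moreover have "\<psi> ` ?T \<subseteq> S (q a)"
    proof
      fix e assume e: "e \<in> \<psi> ` ?T"
      then obtain h where h: "h \<in> ?T" "e = \<psi> h" by (rule imageE)
      then have "q a \<in> e" using q[OF ab(1), of h] q[OF ab(2) xb] ab(3) by auto
      moreover have "e \<in> ?E" using h E[OF subsetD[OF TE h(1)]] by simp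
      ultimately show "e \<in> S (q a)"
        by (auto simp: S_def card_2_iff image_iff doubleton_eq_iff)
    qed
    then have "card (\<psi> ` ?T) \<le> card (S (q a))" using V(1) by (intro card_mono) (auto simp: S_def)
    ultimately show False using cS[of "q a"] qV ab V(3) by auto
  qed
  then have bij: "bij_betw q V V" using qV V(1) by (simp add: bij_betw_def endo_inj_surj)
  \<comment> \<open>\<open>permutes\<close> requires the identity outside \<open>V\<close>, where
    \<open>q\<close> is unconstrained.\<close>
  define p where "p x = (if x \<in> V then q x else x)" for x
  have pq: "p x = q x" if "x \<in> V" for x using that by (simp add: p_def)
  have bijp: "bij_betw p V V" using bij_betw_cong[of V p q V] pq bij by blast
  then have perm: "p permutes V" by (intro bij_imp_permutes) (auto simp: p_def)
  have "\<phi> M = (`) p ` M" if M: "pm V M" for M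
  proof -
    have "(`) p ` M \<subseteq> \<phi> M"
    proof
      fix e assume "e \<in> (`) p ` M"
      then obtain g where g: "g \<in> M" "e = p ` g" by blast
      obtain a b where ab: "g = {a, b}" "a \<noteq> b" using pm_card_edge[OF M g(1)] by (auto simp: card_2_iff)
      have abV: "a \<in> V" "b \<in> V" using pm_edge_subset[OF M g(1)] ab by auto
      have "\<psi> g \<in> ?E" using E pm_card_edge[OF M g(1)] pm_edge_subset[OF M g(1)] by blast
      moreover have "q a \<noteq> q b" using \<open>inj_on q V\<close> abV ab(2) by (auto dest: inj_onD)
      ultimately have "\<psi> g = {q a, q b}" using card2_eq[of "\<psi> g" "q a" "q b"] q2[OF abV ab(2)] ab by auto
      then have "e = \<psi> g" using g ab abV pq by simp
      then show "e \<in> \<phi> M" using mem[OF M g(1)] by simp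
    qed
    then show ?thesis using pm_subset_eq[OF pm_image[OF bijp M] pm_autD(1)[OF aut M]] by simp
  qed
  then show ?thesis using perm by blast
qed

section \<open>Permutation groups regular on matchings\<close>

text \<open>The elements are functions on the whole type that fix everything outside
  \<open>V\<close>, so a group fixing some points of \<open>V\<close> is, unchanged, a group on the
  remaining points.\<close>

definition perm_group :: "'a set \<Rightarrow> ('a \<Rightarrow> 'a) set \<Rightarrow> bool" where
  "perm_group V P \<longleftrightarrow> (\<forall>p\<in>P. p permutes V) \<and> id \<in> P \<and> (\<forall>p\<in>P. \<forall>q\<in>P. p \<circ> q \<in> P) \<and> (\<forall>p\<in>P. inv_into UNIV p \<in> P)"

definition pm_transitive :: "'a set \<Rightarrow> ('a \<Rightarrow> 'a) set \<Rightarrow> bool" where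
  "pm_transitive V P \<longleftrightarrow> (\<forall>M N. pm V M \<longrightarrow> pm V N \<longrightarrow> (\<exists>p\<in>P. (`) p ` M = N))"

definition stab :: "('a \<Rightarrow> 'a) set \<Rightarrow> 'a \<Rightarrow> ('a \<Rightarrow> 'a) set" where
  "stab P a = {p \<in> P. p a = a}"

definition orb :: "('a \<Rightarrow> 'a) set \<Rightarrow> 'a \<Rightarrow> 'a set" where
  "orb P a = (\<lambda>p. p a) ` P"

lemma pm_transitiveE:
  assumes "pm_transitive V P" "pm V M" "pm V N" obtains p where "p \<in> P" "(`) p ` M = N"
  using that assms(1)[unfolded pm_transitive_def, rule_format, OF assms(2,3)] by (elim bexE)

lemma orbE:
  assumes "y \<in> orb P x" obtains q where "q \<in> P" "y = q x"
  using assms by (auto simp: orb_def)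

lemma perm_groupD:
  assumes "perm_group V P"
  shows "p \<in> P \<Longrightarrow> p permutes V" "id \<in> P" "p \<in> P \<Longrightarrow> q \<in> P \<Longrightarrow> p \<circ> q \<in> P" "p \<in> P \<Longrightarrow> inv_into UNIV p \<in> P"
  using assms by (simp_all add: perm_group_def)

lemma perm_group_finite: "perm_group V P \<Longrightarrow> finite V \<Longrightarrow> finite P"
  by (rule finite_subset[OF _ finite_permutations]) (auto simp: perm_group_def)

lemma perm_inv_eq: "p permutes V \<Longrightarrow> inv_into UNIV p (p x) = x" "p permutes V \<Longrightarrow> p (inv_into UNIV p x) = x"
  by (simp_all add: permutes_inverses)

lemma stab_perm_group: "perm_group V P \<Longrightarrow> perm_group V (stab P a)"
  unfolding perm_group_def stab_def by auto (metis perm_inv_eq(1))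

lemma perm_group_restrict:
  assumes "perm_group V P" "\<And>p x. p \<in> P \<Longrightarrow> x \<in> V - W \<Longrightarrow> p x = x"
  shows "perm_group W P"
  unfolding perm_group_def[of W]
proof (intro conjI ballI)
  show "p permutes W" if "p \<in> P" for p
    using permutes_superset[OF perm_groupD(1)[OF assms(1) that]] assms(2)[OF that] .
qed (use perm_groupD[OF assms(1)] in simp_all)

section \<open>Involutions and the parity of the group order\<close>

lemma pm_involution:
  assumes "\<And>x. x \<in> A \<Longrightarrow> i x \<in> A" "\<And>x. x \<in> A \<Longrightarrow> i (i x) = x" "\<And>x. x \<in> A \<Longrightarrow> i x \<noteq> x"
  shows "pm A ((\<lambda>x. {x, i x}) ` A)"
proof (rule pmI)
  fix e assume "e \<in> (\<lambda>x. {x, i x}) ` A"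
  then obtain x where "e = {x, i x}" "x \<in> A" by (rule imageE)
  then show "card e = 2" "e \<subseteq> A" using assms(1,3)[of x] by auto
next
  have "e = {z, i z}" if e: "e \<in> (\<lambda>x. {x, i x}) ` A" "z \<in> e" for e z
  proof -
    obtain x where "e = {x, i x}" "x \<in> A" using e(1) by (rule imageE)
    then show ?thesis using e(2) assms(2)[of x] by auto
  qed
  then show "e = e'" if "e \<in> (\<lambda>x. {x, i x}) ` A" "e' \<in> (\<lambda>x. {x, i x}) ` A" "z \<in> e" "z \<in> e'" for e e' z
    using that by metis
qed auto

lemma even_card_involution:
  assumes "finite A" "\<And>x. x \<in> A \<Longrightarrow> i x \<in> A" "\<And>x. x \<in> A \<Longrightarrow> i (i x) = x" "\<And>x. x \<in> A \<Longrightarrow> i x \<noteq> x"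
  shows "even (card A)"
  using pm_card[OF assms(1) pm_involution[of A i]] assms(2-4) by simp

lemma image_pointwise_fixed: "(\<And>x. x \<in> X \<Longrightarrow> h x = x) \<Longrightarrow> h ` X = X"
  by simp

text \<open>Join each moved point to its image and match the fixed points arbitrarily; the moved
  points are even in number, so the fixed ones are too.\<close>

lemma involution_fixes_pm:
  assumes V: "finite V" "even (card V)" and t: "\<tau> permutes V" "\<And>x. \<tau> (\<tau> x) = x"
  shows "\<exists>M. pm V M \<and> (`) \<tau> ` M = M"
proof -
  define U where "U = {x \<in> V. \<tau> x \<noteq> x}"
  have U: "\<tau> x \<in> U" if "x \<in> U" for x
    using that t(2)[of x] permutes_in_image[OF t(1), of x] by (auto simp: U_def)
  let ?N = "(\<lambda>x. {x, \<tau> x}) ` U"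
  have N: "pm U ?N" using U t(2) by (intro pm_involution) (auto simp: U_def)
  have "finite U" "U \<subseteq> V" using V by (auto simp: U_def)
  then have "even (card (V - U))" using pm_card[OF _ N] V by (simp add: card_Diff_subset)
  then obtain C where C: "pm (V - U) C" using pm_exists[of "V - U"] V by blast
  have "pm V (?N \<union> C)" using pm_Un[OF N C] \<open>U \<subseteq> V\<close> by (metis Diff_disjoint Diff_partition)
  moreover have "\<tau> ` e = e" if "e \<in> ?N \<union> C" for e
    using that
  proof
    assume "e \<in> ?N" then obtain x where "e = {x, \<tau> x}" by (rule imageE)
    then show ?thesis using t(2)[of x] by auto
  next
    assume "e \<in> C"
    then have "\<tau> x = x" if "x \<in> e" for x using pm_edge_subset[OF C] that by (auto simp: U_def)
    then show ?thesis by simp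
  qed
  then have "(`) \<tau> ` (?N \<union> C) = ?N \<union> C" by (rule image_pointwise_fixed)
  ultimately show ?thesis by blast
qed

text \<open>Inversion pairs off the non-identity elements: an element equal to its inverse fixes
  some perfect matching and is therefore the identity.\<close>

lemma odd_card_pm_free:
  assumes V: "finite V" "even (card V)" and P: "perm_group V P"
    and free: "\<And>p M. p \<in> P \<Longrightarrow> pm V M \<Longrightarrow> (`) p ` M = M \<Longrightarrow> p = id"
  shows "odd (card P)"
proof -
  note fin = perm_group_finite[OF P V(1)]
  have "even (card (P - {id}))"
  proof (rule even_card_involution[of _ "inv_into UNIV"])
    show "finite (P - {id})" using fin by simp
  next
    fix p assume p: "p \<in> P - {id}"
    then have pp: "p permutes V" using perm_groupD(1)[OF P] by blast
    show ii: "inv_into UNIV (inv_into UNIV p) = p" using pp by (simp add: permutes_inv_inv)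
    show "inv_into UNIV p \<in> P - {id}" using p perm_groupD(4)[OF P] ii by (metis Diff_iff inv_id singletonD singletonI)
    show "inv_into UNIV p \<noteq> p"
    proof
      assume "inv_into UNIV p = p"
      then have "p (p x) = x" for x using perm_inv_eq(1)[OF pp, of x] by simp
      then obtain M where "pm V M" "(`) p ` M = M" using involution_fixes_pm[OF V pp] by blast
      then show False using free p by blast
    qed
  qed
  then show ?thesis using fin perm_groupD(2)[OF P] card_Suc_Diff1[of P id]
    by (metis even_Suc)
qed

text \<open>Orbit-stabiliser theorem: the fibre of the evaluation at \<open>a\<close> over
  \<open>q a\<close> is the coset of the stabiliser by \<open>q\<close>.\<close>

lemma card_orb_stab:
  assumes "finite V" and P: "perm_group V P"
  shows "card P = card (orb P a) * card (stab P a)"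
proof -
  note fin = perm_group_finite[OF P assms(1)]
  have fib: "card {p \<in> P. p a = y} = card (stab P a)" if y: "y \<in> orb P a" for y
  proof -
    obtain q where q: "q \<in> P" "y = q a" using y by (rule orbE)
    note perm = perm_groupD(1)[OF P q(1)]
    have "bij_betw (\<lambda>p. q \<circ> p) (stab P a) {p \<in> P. p a = y}"
    proof (rule bij_betw_byWitness[where f' = "\<lambda>p. inv_into UNIV q \<circ> p"])
      show "(\<lambda>p. q \<circ> p) ` stab P a \<subseteq> {p \<in> P. p a = y}"
        using q(2) perm_groupD(3)[OF P q(1)] by (simp add: stab_def image_subset_iff)
      show "(\<lambda>p. inv_into UNIV q \<circ> p) ` {p \<in> P. p a = y} \<subseteq> stab P a"
      proof (rule image_subsetI)
        fix p assume "p \<in> {p \<in> P. p a = y}"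
        then show "inv_into UNIV q \<circ> p \<in> stab P a"
          using q(2) perm_groupD(3)[OF P perm_groupD(4)[OF P q(1)], of p] perm_inv_eq(1)[OF perm, of a]
          by (simp add: stab_def)
      qed
    qed (auto simp: fun_eq_iff perm_inv_eq[OF perm])
    then show ?thesis by (simp add: bij_betw_same_card)
  qed
  have "card P = card (\<Union>y\<in>orb P a. {p \<in> P. p a = y})"
    by (rule arg_cong[where f = card]) (auto simp: orb_def)
  also have "\<dots> = (\<Sum>y\<in>orb P a. card {p \<in> P. p a = y})"
    using fin by (intro card_UN_disjoint) (auto simp: orb_def)
  also have "\<dots> = card (orb P a) * card (stab P a)" using fib by simp
  finally show ?thesis .
qed

section \<open>Orbits of groups transitive on matchings\<close>

lemma orb_closed:
  assumes P: "perm_group V P" and p: "p \<in> P" shows "p x \<in> orb P a \<longleftrightarrow> x \<in> orb P a"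
proof -
  have *: "q y \<in> orb P a" if q: "q \<in> P" and y: "y \<in> orb P a" for q y
  proof -
    obtain r where "r \<in> P" "y = r a" using y by (rule orbE)
    then show ?thesis unfolding orb_def
      using perm_groupD(3)[OF P q, of r] by (intro rev_image_eqI[of "q \<circ> r"]) simp_all
  qed
  show ?thesis using *[OF p, of x] *[OF perm_groupD(4)[OF P p], of "p x"] perm_inv_eq(1)[OF perm_groupD(1)[OF P p], of x]
    by auto
qed

lemma orb_self: "perm_group V P \<Longrightarrow> a \<in> orb P a"
  using perm_groupD(2) unfolding orb_def by (metis id_apply rev_image_eqI)

lemma orb_subset: "perm_group V P \<Longrightarrow> a \<in> V \<Longrightarrow> orb P a \<subseteq> V"
  using perm_groupD(1) permutes_in_image unfolding orb_def by fastforce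

lemma pm_switch:
  assumes "finite V" "even (card V)" "distinct [a, b, c, d]" "{a, b, c, d} \<subseteq> V"
  shows "\<exists>R. pm (V - {a, b, c, d}) R \<and> pm V ({{a, b}, {c, d}} \<union> R) \<and> pm V ({{a, c}, {b, d}} \<union> R)"
proof -
  let ?Q = "{a, b, c, d}"
  have "card (V - ?Q) = card V - 4" using assms by (simp add: card_Diff_subset)
  then obtain R where R: "pm (V - ?Q) R" using pm_exists[of "V - ?Q"] assms by auto
  have un: "pm V (X \<union> R)" if "pm ?Q X" for X
    using pm_Un[OF that R] assms(4) by (metis Diff_disjoint Diff_partition)
  have "{a, c, b, d} = ?Q" by auto
  then have "pm ?Q {{a, c}, {b, d}}" using pm_quad[of a c b d] assms(3) by auto
  then show ?thesis using R un pm_quad[OF assms(3)] by blast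
qed

lemma orb_switch:
  assumes V: "finite V" "even (card V)" and P: "perm_group V P" and tr: "pm_transitive V P"
    and ab: "a \<in> orb P x" "b \<in> orb P x" and cd: "c \<notin> orb P x" "d \<notin> orb P x"
    and dist: "a \<noteq> b" "c \<noteq> d" and sub: "{a, b, c, d} \<subseteq> V"
  shows False
proof -
  let ?U = "orb P x"
  have "distinct [a, b, c, d]" using ab cd dist by auto
  then obtain R where R: "pm (V - {a, b, c, d}) R"
    and M: "pm V ({{a, b}, {c, d}} \<union> R)" (is "pm V ?M") and N: "pm V ({{a, c}, {b, d}} \<union> R)" (is "pm V ?N")
    using pm_switch[OF V _ sub] by blast
  obtain p where p: "p \<in> P" "(`) p ` ?M = ?N" using tr M N by (rule pm_transitiveE)
  have injp: "inj p" using perm_groupD(1)[OF P p(1)] by (rule permutes_inj)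
  \<comment> \<open>Elements of \<open>P\<close> preserve the orbit, hence the number of edges
    inside it.\<close>
  define I where "I X = {e \<in> X. e \<subseteq> ?U}" for X
  have "p ` e \<subseteq> ?U \<longleftrightarrow> e \<subseteq> ?U" for e
    using orb_closed[OF P p(1)] unfolding image_subset_iff by blast
  then have "I ((`) p ` X) = (`) p ` I X" for X by (auto simp: I_def)
  then have "I ?N = (`) p ` I ?M" using p(2) by metis
  moreover have "inj_on ((`) p) (I ?M)" using injp by (simp add: inj_on_def inj_image_eq_iff)
  ultimately have "card (I ?N) = card (I ?M)" by (simp add: card_image)
  \<comment> \<open>The switch trades \<open>{a, b}\<close>, which lies inside the orbit, for edges
    leaving it, so the count drops by one.\<close>
  moreover have "I ?N = I R" using cd by (auto simp: I_def)
  moreover have "I ?M = insert {a, b} (I R)" using ab cd by (auto simp: I_def)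
  moreover have "{a, b} \<notin> I R" using pm_edge_subset[OF R] by (auto simp: I_def)
  moreover have "finite (I R)" using pm_finite[OF _ R] V(1) by (simp add: I_def)
  ultimately show False by simp
qed

text \<open>An orbit has odd size, and so has its complement in \<open>V\<close>. By
  \<open>orb_switch\<close> they cannot both have two points, so one of them is a single point. If
  some complement is a point \<open>v\<close>, this is the fixed vertex; otherwise all orbits are
  points.\<close>

lemma pm_transitive_fixes_vertex:
  assumes V: "finite V" "even (card V)" "card V \<ge> 4" and P: "perm_group V P" and tr: "pm_transitive V P"
    and odd: "odd (card P)"
  shows "\<exists>v\<in>V. (\<forall>p\<in>P. p v = v) \<and> (\<forall>x\<in>V - {v}. orb P x = V - {v})"
proof -
  have alt: "card (orb P x) = 1 \<or> card (V - orb P x) = 1" if x: "x \<in> V" for x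
  proof (rule ccontr)
    assume no: "\<not> ?thesis"
    have sub: "orb P x \<subseteq> V" using orb_subset[OF P x] .
    have "odd (card (orb P x))" using odd card_orb_stab[OF V(1) P, of x] by simp
    moreover have "card (V - orb P x) = card V - card (orb P x)" "card (orb P x) \<le> card V"
      using sub V(1) by (auto simp: card_Diff_subset finite_subset intro: card_mono)
    ultimately have "card (orb P x) \<ge> 2" "card (V - orb P x) \<ge> 2" using no V(2) by presburger+
    moreover obtain S where S: "S \<subseteq> orb P x" "card S = 2" using calculation(1) by (rule obtain_subset_with_card_n)
    moreover obtain T where T: "T \<subseteq> V - orb P x" "card T = 2" using calculation(2) by (rule obtain_subset_with_card_n)
    obtain a b where "S = {a, b}" "a \<noteq> b" using S by (auto simp: card_2_iff)
    moreover obtain c d where "T = {c, d}" "c \<noteq> d" using T by (auto simp: card_2_iff)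
    ultimately show False using orb_switch[OF V(1,2) P tr, of a x b c d] S T sub by auto
  qed
  show ?thesis
  proof (cases "\<exists>x\<in>V. card (V - orb P x) = 1")
    case True
    then obtain x v where x: "x \<in> V" and v: "V - orb P x = {v}" by (metis card_1_singletonE)
    then have vV: "v \<in> V" "v \<notin> orb P x" by auto
    have "p v = v" if p: "p \<in> P" for p
      using orb_closed[OF P p, of v x] permutes_in_image[OF perm_groupD(1)[OF P p], of v] v vV by blast
    moreover have ox: "orb P x = V - {v}" using v orb_subset[OF P x] by auto
    have "orb P y = V - {v}" if y: "y \<in> V - {v}" for y
    proof -
      obtain q where q: "q \<in> P" "y = q x" using y ox by (metis orbE)
      have "z \<in> orb P y" if z: "z \<in> V - {v}" for z
      proof -
        obtain r where r: "r \<in> P" "z = r x" using z ox by (metis orbE)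
        have "z = (r \<circ> inv_into UNIV q) y" using q r perm_inv_eq(1)[OF perm_groupD(1)[OF P q(1)]] by simp
        moreover have "r \<circ> inv_into UNIV q \<in> P" using perm_groupD(3)[OF P r(1) perm_groupD(4)[OF P q(1)]] .
        ultimately show ?thesis unfolding orb_def by (rule rev_image_eqI[rotated])
      qed
      moreover have "orb P y \<subseteq> orb P x"
        using orb_closed[OF P, of _ y x] y ox unfolding orb_def[of P y] by blast
      ultimately show ?thesis using ox by blast
    qed
    ultimately show ?thesis using vV by blast
  next
    case False
    \<comment> \<open>All orbits being points, \<open>P\<close> acts trivially and cannot carry one
      matching to a different one, as transitivity demands.\<close>
    have fix_all: "p x = x" if "p \<in> P" "x \<in> V" for p x
    proof -
      have "card (orb P x) = 1" using alt[OF that(2)] False that(2) by blast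
      then obtain y where "orb P x = {y}" by (rule card_1_singletonE)
      moreover have "p x \<in> orb P x" using that(1) by (auto simp: orb_def)
      ultimately show ?thesis using orb_self[OF P, of x] by simp
    qed
    obtain Q where Q: "Q \<subseteq> V" "card Q = 4" using V(3) by (meson obtain_subset_with_card_n)
    obtain a b c d where "Q = {a, b, c, d}" "distinct [a, b, c, d]"
      using Q(2) by (auto simp: card_Suc_eq numeral_eq_Suc)
    then have abcd: "{a, b, c, d} \<subseteq> V" "distinct [a, b, c, d]" using Q(1) by simp_all
    then obtain R where R: "pm (V - {a, b, c, d}) R" "pm V ({{a, b}, {c, d}} \<union> R)" (is "pm V ?M")
      "pm V ({{a, c}, {b, d}} \<union> R)" (is "pm V ?N")
      using pm_switch[OF V(1,2)] by blast
    obtain p where p: "p \<in> P" "(`) p ` ?M = ?N" using tr R(2,3) by (rule pm_transitiveE)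
    have "p ` e = e" if "e \<in> ?M" for e
      using fix_all[OF p(1)] pm_edge_subset[OF R(2) that] by (force simp: image_iff)
    then have "(`) p ` ?M = ?M" by (rule image_pointwise_fixed)
    then have "?N = ?M" using p(2) by (metis (no_types))
    then have "{a, b} \<in> ?N" by simp
    moreover have "{a, b} \<notin> R" using pm_edge_subset[OF R(1)] by auto
    ultimately show ?thesis using abcd(2) by (auto simp: doubleton_eq_iff)
  qed
qed

text \<open>Add the edge \<open>{v, a}\<close> to both matchings. An element carrying one to the
  other fixes \<open>v\<close>, hence preserves the edge at \<open>v\<close>, and so fixes
  \<open>a\<close>.\<close>

lemma stab_pm_transitive:
  assumes P: "perm_group V P" and tr: "pm_transitive V P" and v: "v \<in> V" "\<And>p. p \<in> P \<Longrightarrow> p v = v"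
    and a: "a \<in> V" "a \<noteq> v"
  shows "pm_transitive (V - {v, a}) (stab P a)"
  unfolding pm_transitive_def
proof (intro allI impI)
  fix M N assume M: "pm (V - {v, a}) M" and N: "pm (V - {v, a}) N"
  let ?e = "{v, a}"
  have M': "pm V (insert ?e M)" and N': "pm V (insert ?e N)" using pm_insert[of V ?e] M N v(1) a by auto
  obtain p where p: "p \<in> P" "(`) p ` insert ?e M = insert ?e N" using tr M' N' by (rule pm_transitiveE)
  have "p ` ?e \<in> (`) p ` insert ?e M" by simp
  then have "p ` ?e \<in> insert ?e N" unfolding p(2) .
  moreover have "p v \<in> p ` ?e" by simp
  then have "v \<in> p ` ?e" using v(2)[OF p(1)] by simp
  ultimately have "p ` ?e = ?e" using pm_edge_eq[OF N', of "p ` ?e" ?e v] by simp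
  then have pa: "p a = a" using v(2)[OF p(1)] a by (auto simp: doubleton_eq_iff)
  have perm: "p permutes V - {v, a}"
    using permutes_superset[OF perm_groupD(1)[OF P p(1)], of "V - {v, a}"] v(2)[OF p(1)] pa by auto
  then have pM: "pm (V - {v, a}) ((`) p ` M)" using pm_image permutes_imp_bij M by blast
  then have "?e \<notin> (`) p ` M" using pm_edge_subset by blast
  moreover have "(`) p ` M \<subseteq> insert ?e N" using p(2) by (metis image_mono subset_insertI)
  ultimately have "(`) p ` M \<subseteq> N" by blast
  then have "(`) p ` M = N" using pm_subset_eq pM N by blast
  then show "\<exists>p\<in>stab P a. (`) p ` M = N" using p(1) pa by (auto simp: stab_def)
qed

theorem no_regular_perm_group:
  assumes V: "finite V" "even (card V)" "card V \<ge> 6" and P: "perm_group V P" and tr: "pm_transitive V P"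
    and free: "\<And>p M. p \<in> P \<Longrightarrow> pm V M \<Longrightarrow> (`) p ` M = M \<Longrightarrow> p = id"
  shows False
proof -
  have odd: "odd (card P)" using odd_card_pm_free[OF V(1,2) P free] .
  have c4: "card V \<ge> 4" using V(3) by simp
  obtain v where v: "v \<in> V" "\<And>p. p \<in> P \<Longrightarrow> p v = v" and orbW: "\<And>x. x \<in> V - {v} \<Longrightarrow> orb P x = V - {v}"
    using pm_transitive_fixes_vertex[OF V(1,2) c4 P tr odd] by blast
  define W where "W = V - {v}"
  \<comment> \<open>The stabiliser of \<open>a\<close> has odd order and is transitive on the
    matchings of the at least four points other than \<open>v\<close> and \<open>a\<close>, so the
    fixed-vertex lemma applies again.\<close>
  have ex: "\<exists>b\<in>W - {a}. (\<forall>p\<in>stab P a. p b = b) \<and> (\<forall>b'\<in>W - {a}. (\<forall>p\<in>stab P a. p b' = b') \<longrightarrow> b' = b)"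
    if a: "a \<in> W" for a
  proof -
    have a': "a \<in> V" "a \<noteq> v" using a by (auto simp: W_def)
    let ?V = "V - {v, a}"
    have WV: "W - {a} = ?V" by (auto simp: W_def)
    have "perm_group ?V (stab P a)"
      by (rule perm_group_restrict[OF stab_perm_group[OF P]]) (use v(2) in \<open>auto simp: stab_def\<close>)
    moreover have "pm_transitive ?V (stab P a)" by (rule stab_pm_transitive) (use P tr v a' in auto)
    moreover have cV: "card ?V = card V - 2" using a' v(1) V(1) by (simp add: card_Diff_subset)
    moreover have "odd (card (stab P a))" using odd card_orb_stab[OF V(1) P, of a] by simp
    moreover have "finite ?V" "even (card ?V)" "card ?V \<ge> 4" using cV V by simp_all
    ultimately have "\<exists>b\<in>?V. (\<forall>p\<in>stab P a. p b = b) \<and> (\<forall>x\<in>?V - {b}. orb (stab P a) x = ?V - {b})"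
      by (intro pm_transitive_fixes_vertex)
    then obtain b where b: "b \<in> ?V" "\<forall>p\<in>stab P a. p b = b"
      and orb: "\<And>x. x \<in> ?V - {b} \<Longrightarrow> orb (stab P a) x = ?V - {b}" by blast
    \<comment> \<open>A second fixed point would have a one-point orbit that is everything except
      \<open>b\<close>, leaving at most two points.\<close>
    have "b' = b" if b': "b' \<in> ?V" "\<forall>p\<in>stab P a. p b' = b'" for b'
    proof (rule ccontr)
      assume "b' \<noteq> b"
      then have "orb (stab P a) b' = ?V - {b}" using orb b' by blast
      moreover have "orb (stab P a) b' \<subseteq> {b'}" using b'(2) by (auto simp: orb_def)
      ultimately have "?V \<subseteq> {b, b'}" by blast
      then have "card ?V \<le> card {b, b'}" by (intro card_mono) auto
      also have "\<dots> \<le> 2" using card_length[of "[b, b']"] by simp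
      finally show False using cV V(3) by simp
    qed
    then show ?thesis using b WV by blast
  qed
  then obtain s where s: "\<And>a. a \<in> W \<Longrightarrow> s a \<in> W - {a}" "\<And>a p. a \<in> W \<Longrightarrow> p \<in> stab P a \<Longrightarrow> p (s a) = s a"
    and uniq: "\<And>a b. a \<in> W \<Longrightarrow> b \<in> W - {a} \<Longrightarrow> (\<forall>p\<in>stab P a. p b = b) \<Longrightarrow> b = s a"
    by metis
  \<comment> \<open>The stabiliser of \<open>a\<close> lies in that of \<open>s a\<close>. Both have
    the same order because both orbits are \<open>W\<close>; so they agree, and \<open>a\<close> is
    the point fixed by the stabiliser of \<open>s a\<close>.\<close>
  have "s (s a) = a" if a: "a \<in> W" for a
  proof -
    have sa: "s a \<in> W" "s a \<noteq> a" using s(1)[OF a] by auto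
    have "stab P a \<subseteq> stab P (s a)" using s(2)[OF a] by (auto simp: stab_def)
    moreover have "finite (stab P (s a))" using perm_group_finite[OF P V(1)] by (simp add: stab_def)
    moreover have "card (stab P a) = card (stab P (s a))"
    proof -
      have "orb P a = W" "orb P (s a) = W" using orbW a sa(1) by (auto simp: W_def)
      moreover have "card W > 0" using a V(1) by (auto simp: W_def card_gt_0_iff)
      ultimately show ?thesis using card_orb_stab[OF V(1) P, of a] card_orb_stab[OF V(1) P, of "s a"] by simp
    qed
    ultimately have "stab P (s a) = stab P a" using card_subset_eq by metis
    then show ?thesis using uniq[OF sa(1), of a] a sa(2) by (auto simp: stab_def)
  qed
  then have "even (card W)" using even_card_involution[of W s] s(1) V(1) by (auto simp: W_def)
  moreover have "card W = card V - 1" using v(1) V(1) by (simp add: W_def)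
  ultimately show False using V(2,3) by simp
qed

section \<open>From Cayley graphs to permutation groups\<close>

lemma perfect_matching_iff_pm: "perfect_matching n M \<longleftrightarrow> pm {..<n} M"
proof
  assume M: "perfect_matching n M"
  have ce: "e \<in> complete_edges n" if "e \<in> M" for e
    using M that by (auto simp: perfect_matching_def)
  have ex1: "\<exists>!e. e \<in> M \<and> v \<in> e" if "v < n" for v
    using M that by (simp add: perfect_matching_def)
  show "pm {..<n} M"
  proof (rule pmI)
    show "card e = 2" "e \<subseteq> {..<n}" if "e \<in> M" for e
      using ce[OF that] by (auto simp: complete_edges_def)
    then show "e = e'" if "e \<in> M" "e' \<in> M" "x \<in> e" "x \<in> e'" for e e' x
      using that ex1[of x] by auto
    show "\<exists>e\<in>M. v \<in> e" if "v \<in> {..<n}" for v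
      using ex1[of v] that by auto
  qed
next
  assume M: "pm {..<n} M"
  have "e \<in> complete_edges n" if "e \<in> M" for e
    using pm_card_edge[OF M that] pm_edge_subset[OF M that] unfolding complete_edges_def card_2_iff by auto
  moreover have "\<exists>!e. e \<in> M \<and> v \<in> e" if "v < n" for v
    using pm_cover[OF M, of v] pm_edge_eq[OF M] that by auto
  ultimately show "perfect_matching n M" by (auto simp: perfect_matching_def)
qed

text \<open>Suppose \<open>p\<close> moves \<open>a\<close> to \<open>b\<close>. In a matching
  containing \<open>{a, c}\<close> and \<open>{b, x}\<close>, the image of the first edge is the
  edge at \<open>b\<close>, so \<open>p c = x\<close>. This holds for two different
  \<open>x\<close>, which is absurd.\<close>

lemma pm_faithful:
  assumes V: "finite V" "even (card V)" "card V \<ge> 6" and p: "p permutes V"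
    and fix_pm: "\<And>M. pm V M \<Longrightarrow> (`) p ` M = M"
  shows "p = id"
proof (rule ccontr)
  assume "p \<noteq> id"
  then obtain a where a: "p a \<noteq> a" by (auto simp: fun_eq_iff)
  then have aV: "a \<in> V" "p a \<in> V" using p permutes_not_in permutes_in_image by metis+
  let ?b = "p a"
  have "card (V - {a, ?b}) = card V - 2" using aV a V(1) by (simp add: card_Diff_subset)
  then have "card (V - {a, ?b}) \<ge> 3" using V(3) by simp
  then obtain S where S: "S \<subseteq> V - {a, ?b}" "card S = 3" by (meson obtain_subset_with_card_n)
  then obtain c d d' where "S = {c, d, d'}" "c \<noteq> d" "c \<noteq> d'" "d \<noteq> d'" by (auto simp: card_3_iff)
  then have cd: "c \<in> V" "d \<in> V" "d' \<in> V" "c \<noteq> d" "c \<noteq> d'" "d \<noteq> d'" "c \<notin> {a, ?b}" "d \<notin> {a, ?b}" "d' \<notin> {a, ?b}"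
    using S(1) by auto
  have "p c = x" if x: "x \<in> V" "x \<noteq> c" "x \<notin> {a, ?b}" for x
  proof -
    obtain M where M: "pm V M" "{a, c} \<in> M" "{?b, x} \<in> M"
      using pm_contains_disjoint_edges[OF V(1,2), of "{a, c}" "{?b, x}"] a aV cd x by auto
    have "p ` {a, c} \<in> (`) p ` M" using M(2) by (rule imageI)
    then have "p ` {a, c} \<in> M" unfolding fix_pm[OF M(1)] .
    then have "p ` {a, c} = {?b, x}" using pm_edge_eq[OF M(1) _ M(3), of "p ` {a, c}" ?b] by simp
    moreover have "p c \<noteq> ?b" using permutes_inj[OF p] cd(7) by (auto dest: injD)
    ultimately show ?thesis by (auto simp: doubleton_eq_iff)
  qed
  then show False using cd by metis
qed

text \<open>Adjacency depends only on the quotient of \<open>h\<close> by \<open>g\<close>, which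
  right translation leaves unchanged.\<close>

lemma cayley_translation_pm_aut:
  fixes G (structure)
  assumes iso: "cayley_iso G C (PM_vertices n) PM_adj f" and g: "g \<in> carrier G"
  defines "f' \<equiv> the_inv_into (carrier G) f"
  shows "pm_aut {..<n} (\<lambda>M. f (f' M \<otimes> g)) (\<lambda>M. f (f' M \<otimes> inv g))"
proof -
  have G: "group G" and bij: "bij_betw f (carrier G) {M. pm {..<n} M}"
    and adj: "\<And>g h. g \<in> carrier G \<Longrightarrow> h \<in> carrier G \<Longrightarrow> h \<otimes> inv g \<in> C \<longleftrightarrow> f g \<inter> f h = {}"
    using iso by (auto simp: cayley_iso_def cayley_connection_set_def cayley_adj_def PM_adj_def
        PM_vertices_def perfect_matching_iff_pm)
  interpret group G by (rule G)
  have f: "pm {..<n} (f x)" "f' (f x) = x" if "x \<in> carrier G" for x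
    using that bij by (auto simp: f'_def bij_betw_def the_inv_into_f_f)
  have f': "f' M \<in> carrier G" "f (f' M) = M" if "pm {..<n} M" for M
    using that bij the_inv_into_into[of f "carrier G" M "carrier G"] f_the_inv_into_f[of f "carrier G" M]
    by (auto simp: f'_def bij_betw_def)
  have "f (f' M \<otimes> g) \<inter> f (f' N \<otimes> g) = {} \<longleftrightarrow> M \<inter> N = {}" if "pm {..<n} M" "pm {..<n} N" for M N
  proof -
    note c = f'(1)[OF that(1)] f'(1)[OF that(2)]
    have "(f' N \<otimes> g) \<otimes> inv (f' M \<otimes> g) = f' N \<otimes> inv (f' M)"
      using c g by (simp add: inv_mult_group m_assoc[symmetric]) (simp add: m_assoc)
    then show ?thesis using adj[of "f' M \<otimes> g" "f' N \<otimes> g"] adj[OF c] c g f'(2) that by simp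
  qed
  then show ?thesis unfolding pm_aut_def using f f' g by (simp add: m_assoc)
qed

lemma cayley_iso_gives_regular_perm_group:
  assumes iso: "cayley_iso G C (PM_vertices n) PM_adj f" and n: "even n" "n \<ge> 6"
  shows "\<exists>P. perm_group {..<n} P \<and> pm_transitive {..<n} P
    \<and> (\<forall>p\<in>P. \<forall>M. pm {..<n} M \<longrightarrow> (`) p ` M = M \<longrightarrow> p = id)"
proof -
  let ?V = "{..<n}"
  have V: "finite ?V" "even (card ?V)" "card ?V \<ge> 6" using n by simp_all
  define f' where "f' = the_inv_into (carrier G) f"
  define \<phi> where "\<phi> g M = f (f' M \<otimes>\<^bsub>G\<^esub> g)" for g M
  have G: "group G" and bij: "bij_betw f (carrier G) {M. pm ?V M}"
    using iso by (auto simp: cayley_iso_def cayley_connection_set_def PM_vertices_def perfect_matching_iff_pm)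
  interpret group G by (rule G)
  have f: "pm ?V (f x)" "f' (f x) = x" if "x \<in> carrier G" for x
    using that bij by (auto simp: f'_def bij_betw_def the_inv_into_f_f)
  have f': "f' M \<in> carrier G" "f (f' M) = M" if "pm ?V M" for M
    using that bij the_inv_into_into[of f "carrier G" M "carrier G"] f_the_inv_into_f[of f "carrier G" M]
    by (auto simp: f'_def bij_betw_def)
  \<comment> \<open>Collecting all permutations that induce some right translation avoids choosing
    one for each group element and makes closure immediate.\<close>
  define P where "P = {p. p permutes ?V \<and> (\<exists>g\<in>carrier G. \<forall>M. pm ?V M \<longrightarrow> (`) p ` M = \<phi> g M)}"
  have ex: "\<exists>p\<in>P. \<forall>M. pm ?V M \<longrightarrow> (`) p ` M = \<phi> g M" if g: "g \<in> carrier G" for g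
  proof -
    obtain p where "p permutes ?V" "\<forall>M. pm ?V M \<longrightarrow> \<phi> g M = (`) p ` M"
      using pm_aut_vertex_perm[OF V cayley_translation_pm_aut[OF iso g]] unfolding \<phi>_def f'_def by blast
    then show ?thesis using g unfolding P_def by (intro bexI[of _ p]) (auto intro!: bexI[of _ g])
  qed
  have "perm_group ?V P"
    unfolding perm_group_def
  proof (intro conjI ballI)
    show "p permutes ?V" if "p \<in> P" for p using that by (simp add: P_def)
    have "(`) id ` M = \<phi> \<one>\<^bsub>G\<^esub> M" if "pm ?V M" for M using f'[OF that] by (simp add: \<phi>_def)
    then show "id \<in> P" unfolding P_def using permutes_id by auto
  next
    fix p q assume "p \<in> P" "q \<in> P"
    obtain g where p: "p permutes ?V" "g \<in> carrier G" "\<And>M. pm ?V M \<Longrightarrow> (`) p ` M = \<phi> g M"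
      using \<open>p \<in> P\<close> unfolding P_def by blast
    obtain h where q: "q permutes ?V" "h \<in> carrier G" "\<And>M. pm ?V M \<Longrightarrow> (`) q ` M = \<phi> h M"
      using \<open>q \<in> P\<close> unfolding P_def by blast
    \<comment> \<open>Right translations compose in reverse order: \<open>q\<close> multiplies by
      \<open>h\<close> first, then \<open>p\<close> by \<open>g\<close>.\<close>
    have "(`) (p \<circ> q) ` M = \<phi> (h \<otimes>\<^bsub>G\<^esub> g) M" if M: "pm ?V M" for M
    proof -
      have "(`) (p \<circ> q) ` M = (`) p ` ((`) q ` M)" by (simp add: image_comp comp_def image_image)
      also have "\<dots> = \<phi> g (\<phi> h M)" using p(3)[OF pm_image[OF permutes_imp_bij[OF q(1)] M]] q(3)[OF M] by simp
      finally show ?thesis using f' f M p(2) q(2) by (simp add: \<phi>_def m_assoc)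
    qed
    then show "p \<circ> q \<in> P" unfolding P_def using permutes_compose[OF q(1) p(1)] m_closed[OF q(2) p(2)] by blast
  next
    fix p assume "p \<in> P"
    then obtain g where p: "p permutes ?V" "g \<in> carrier G" "\<And>M. pm ?V M \<Longrightarrow> (`) p ` M = \<phi> g M"
      unfolding P_def by blast
    have pp: "inv_into UNIV p permutes ?V" using permutes_inv[OF p(1)] .
    have "(`) (inv_into UNIV p) ` M = \<phi> (inv\<^bsub>G\<^esub> g) M" if M: "pm ?V M" for M
    proof -
      have N: "pm ?V (\<phi> (inv\<^bsub>G\<^esub> g) M)" using f f' M p(2) by (simp add: \<phi>_def)
      have "M = \<phi> g (\<phi> (inv\<^bsub>G\<^esub> g) M)" using f f' M p(2) by (simp add: \<phi>_def m_assoc)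
      also have "\<dots> = (`) p ` \<phi> (inv\<^bsub>G\<^esub> g) M" using p(3)[OF N] by simp
      finally have "(`) (inv_into UNIV p) ` M = (`) (inv_into UNIV p) ` (`) p ` \<phi> (inv\<^bsub>G\<^esub> g) M" by simp
      also have "\<dots> = \<phi> (inv\<^bsub>G\<^esub> g) M"
        using perm_inv_eq(1)[OF p(1)] by (simp add: image_image)
      finally show ?thesis .
    qed
    then show "inv_into UNIV p \<in> P" unfolding P_def using pp inv_closed[OF p(2)] by blast
  qed
  moreover have "pm_transitive ?V P"
    unfolding pm_transitive_def
  proof (intro allI impI)
    fix M N assume M: "pm ?V M" and N: "pm ?V N"
    note c = f'(1)[OF M] f'(1)[OF N]
    then have g: "inv\<^bsub>G\<^esub> f' M \<otimes>\<^bsub>G\<^esub> f' N \<in> carrier G" by simp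
    have "\<phi> (inv\<^bsub>G\<^esub> f' M \<otimes>\<^bsub>G\<^esub> f' N) M = N"
      using c f'(2)[OF N] by (simp add: \<phi>_def m_assoc[symmetric])
    then show "\<exists>p\<in>P. (`) p ` M = N" using ex[OF g] M by metis
  qed
  moreover have "p = id" if "p \<in> P" and M: "pm ?V M" "(`) p ` M = M" for p M
  proof -
    obtain g where p: "p permutes ?V" "g \<in> carrier G" "\<And>M. pm ?V M \<Longrightarrow> (`) p ` M = \<phi> g M"
      using \<open>p \<in> P\<close> unfolding P_def by blast
    \<comment> \<open>One fixed matching forces \<open>g\<close> to be the identity; then
      \<open>p\<close> fixes every matching and faithfulness applies.\<close>
    have "f' (f (f' M \<otimes>\<^bsub>G\<^esub> g)) = f' M" using p(3)[OF M(1)] M(2) by (simp add: \<phi>_def)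
    then have "f' M \<otimes>\<^bsub>G\<^esub> g = f' M" using f f'[OF M(1)] p(2) by simp
    then have "g = \<one>\<^bsub>G\<^esub>" using f'(1)[OF M(1)] p(2) by simp
    then have "(`) p ` N = N" if "pm ?V N" for N using p(3)[OF that] f'[OF that] by (simp add: \<phi>_def)
    then show ?thesis using pm_faithful[OF V p(1)] by blast
  qed
  ultimately show ?thesis by blast
qed

theorem theorem10p2:
  fixes k :: nat and G :: "'g monoid" and C :: "'g set" and f :: "'g \<Rightarrow> nat set set"
  assumes "k \<ge> 3"
  shows "\<not> cayley_iso G C (PM_vertices (2 * k)) PM_adj f"
proof
  assume "cayley_iso G C (PM_vertices (2 * k)) PM_adj f"
  then obtain P where "perm_group {..<2 * k} P" "pm_transitive {..<2 * k} P"
    "\<forall>p\<in>P. \<forall>M. pm {..<2 * k} M \<longrightarrow> (`) p ` M = M \<longrightarrow> p = id"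
    using cayley_iso_gives_regular_perm_group[of G C "2 * k" f] assms by auto
  then show False using no_regular_perm_group[of "{..<2 * k}" P] assms by auto
qed

end
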